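(* Let $1 \leq p < \infty$ and $\alpha > 0$. For $f \in B^{\infty,1}_\alpha$ set $$s_1(f) = \operatorname{dist}_{B^{\infty,1}_\alpha}(f, B^{p,1}_\alpha) = \inf_{g \in B^{p,1}_\alpha} \| f-g\|_{B^{\infty,1}_\alpha},$$ $$s_2(f) = \inf\left\{ \epsilon > 0 : \int_0^1 \chi_{L_{\epsilon,\alpha}(f)}(r)\,(1-r)^{-1}\,dr < \infty \right\}.$$ Then $s_1(f) \asymp s_2(f)$, with constants depending only on $p$, $\alpha$ and $n$; that is, there is a constant $C \geq 1$ depending only on $p,\alpha,n$ such that $C^{-1}s_2(f) \leq s_1(f) \leq C s_2(f)$ for every $f \in B^{\infty,1}_\alpha$.
   Context: $\mathbb B$ is the open unit ball in $\mathbb R^n$, $\mathbb S = \partial\mathbb B$ is the unit sphere, and $h(\mathbb B)$ is the space of all harmonic functions on $\mathbb B$. Points are written $x = rx'$ with $r=|x|$, $x'\in\mathbb S$. Normalized Lebesgue measure on $\mathbb B$ is $dx = r^{n-1}\,dr\,dx'$ with $\int_{\mathbb B}dx = 1$; thus $dx'$ denotes the correspondingly normalized surface measure on $\mathbb S$. For $f \in h(\mathbb B)$ and $0\le r<1$, $M_1(f,r) = \int_{\mathbb S}|f(rx')|\,dx'$. For $\alpha>0$ and $0<p<\infty$, $$B^{\infty,1}_\alpha = \Big\{ f\in h(\mathbb B): \|f\|_{B^{\infty,1}_\alpha} = \sup_{0\le r<1} M_1(f,r)(1-r)^\alpha<\infty\Big\},$$ $$B^{p,1}_\alpha = \Big\{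 f\in h(\mathbb B): \|f\|_{B^{p,1}_\alpha} = \Big(\int_0^1 M_1(f,r)^p(1-r)^{\alpha p-1}\,dr\Big)^{1/p}<\infty\Big\}.$$ One has $B^{p,1}_\alpha \subset B^{\infty,1}_\alpha$. For $\epsilon>0$, $\alpha>0$ and $f\in h(\mathbb B)$, $$L_{\epsilon,\alpha}(f) = \Big\{ r\in[0,1) : (1-r)^\alpha\int_{\mathbb S}|f(rx')|\,dx' \ge \epsilon\Big\},$$ and $\chi_E$ denotes the characteristic function of a set $E$. *)

theory Defs
  imports "HOL-Analysis.Analysis"
begin

definition partial_derivative :: "('a::euclidean_space \<Rightarrow> real) \<Rightarrow> 'a \<Rightarrow> 'a \<Rightarrow> real" where
  "partial_derivative f b x = frechet_derivative f (at x) b"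

definition laplacian :: "('a::euclidean_space \<Rightarrow> real) \<Rightarrow> 'a \<Rightarrow> real" where
  "laplacian f x = (\<Sum>b\<in>Basis. partial_derivative (partial_derivative f b) b x)"

text \<open>\<open>C2_on\<close> is meant for open \<open>U\<close>, where \<open>differentiable_on\<close> is
  differentiability at every point.\<close>

definition C2_on :: "'a::euclidean_space set \<Rightarrow> ('a \<Rightarrow> real) \<Rightarrow> bool" where
  "C2_on U f \<longleftrightarrow>
     f differentiable_on U \<and>
     (\<forall>b\<in>Basis. partial_derivative f b differentiable_on U) \<and>
     (\<forall>b\<in>Basis. \<forall>c\<in>Basis. continuous_on U (partial_derivative (partial_derivative f b) c))"

text \<open>A function on the unit ball is represented by a total function whose values outside
  the ball are irrelevant.\<close>

definition harmonic_on_ball :: "('a::euclidean_space \<Rightarrow> real) set" where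
  "harmonic_on_ball = {f. C2_on (ball 0 1) f \<and> (\<forall>x\<in>ball 0 1. laplacian f x = 0)}"

text \<open>The surface measure \<open>dx'\<close> on the unit sphere, normalized so that
  \<open>dx = r^(n-1) dr dx'\<close> has total mass \<open>1\<close> on the unit ball. Integrating over \<open>0 < r < 1\<close>,
  the mass of a Borel set \<open>A\<close> of the sphere is \<open>n\<close> times the normalized volume of the
  sector \<open>{x. 0 < norm x < 1 \<and> x / norm x \<in> A}\<close>; the total mass is \<open>n\<close>.
  The underlying space is the sphere itself, so that only the values of an integrand on the
  sphere matter, also for measurability.\<close>

definition sphere_measure :: "'a::euclidean_space measure" where
  "sphere_measure =
     scale_measure (ennreal (DIM('a) / measure lborel (ball (0::'a) 1)))
       (distr (restrict_space lborel (ball 0 1 - {0})) (restrict_space borel (sphere 0 1)) sgn)"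

lemma emeasure_sphere_measure:
  fixes A :: "'a::euclidean_space set"
  assumes "A \<in> sets borel" "A \<subseteq> sphere 0 1"
  shows "emeasure sphere_measure A =
    ennreal (DIM('a) / measure lborel (ball (0::'a) 1)) *
    emeasure lborel {x \<in> ball 0 1 - {0}. sgn x \<in> A}"
proof -
  let ?B = "ball 0 1 - {0} :: 'a set"
  have B: "?B \<in> sets borel" by auto
  have "sgn \<in> borel_measurable (restrict_space borel ?B)"
    by (rule borel_measurable_continuous_on_restrict) (auto intro!: continuous_intros)
  then have m: "sgn \<in> restrict_space lborel ?B \<rightarrow>\<^sub>M restrict_space borel (sphere 0 1)"
    by (intro measurable_restrict_space2)
       (auto simp: space_restrict_space norm_sgn measurable_def sets_restrict_space)
  have A: "A \<in> sets (restrict_space borel (sphere 0 1))"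
    using assms by (auto simp: sets_restrict_space_iff)
  have "sgn -` A \<inter> space (restrict_space lborel ?B) = {x \<in> ?B. sgn x \<in> A}"
    by (auto simp: space_restrict_space)
  then show ?thesis
    using B unfolding sphere_measure_def
    by (simp add: emeasure_distr[OF m A])
       (subst emeasure_restrict_space; auto)
qed

lemma emeasure_sphere_measure_sphere:
  "emeasure sphere_measure (sphere (0::'a::euclidean_space) 1) = DIM('a)"
proof -
  have "{x \<in> ball 0 1 - {0}. sgn x \<in> sphere (0::'a) 1} = ball 0 1 - {0}"
    by (auto simp: norm_sgn)
  moreover have "emeasure lborel (ball (0::'a) 1 - {0}) = ennreal (measure lborel (ball (0::'a) 1))"
    using emeasure_lborel_ball_finite[of "0::'a" 1]
    by (subst emeasure_Diff) (auto simp: emeasure_eq_ennreal_measure less_top)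
  moreover have "measure lborel (ball (0::'a) 1) > 0"
    by (simp add: content_ball_pos)
  ultimately show ?thesis
    by (simp add: emeasure_sphere_measure ennreal_mult[symmetric] ennreal_of_nat_eq_real_of_nat)
qed

definition M1 :: "('a::euclidean_space \<Rightarrow> real) \<Rightarrow> real \<Rightarrow> real" where
  "M1 f r = (\<integral>x. \<bar>f (r *\<^sub>R x)\<bar> \<partial>sphere_measure)"

definition norm_B_inf :: "real \<Rightarrow> ('a::euclidean_space \<Rightarrow> real) \<Rightarrow> ennreal" where
  "norm_B_inf \<alpha> f = (SUP r\<in>{0..<1}. ennreal (M1 f r * (1 - r) powr \<alpha>))"

definition B_inf :: "real \<Rightarrow> ('a::euclidean_space \<Rightarrow> real) set" where
  "B_inf \<alpha> = {f \<in> harmonic_on_ball. norm_B_inf \<alpha> f < \<infinity>}"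

text \<open>Only the set \<open>B^(p,1)\<close> is needed, not its norm; the \<open>p\<close>-th root
  does not affect finiteness.\<close>

definition B_p :: "real \<Rightarrow> real \<Rightarrow> ('a::euclidean_space \<Rightarrow> real) set" where
  "B_p p \<alpha> = {f \<in> harmonic_on_ball.
     (\<integral>\<^sup>+r\<in>{0..<1}. ennreal (M1 f r powr p * (1 - r) powr (\<alpha> * p - 1)) \<partial>lborel) < \<infinity>}"

definition L_set :: "real \<Rightarrow> real \<Rightarrow> ('a::euclidean_space \<Rightarrow> real) \<Rightarrow> real set" where
  "L_set \<epsilon> \<alpha> f = {r \<in> {0..<1}. (1 - r) powr \<alpha> * M1 f r \<ge> \<epsilon>}"

definition s1 :: "real \<Rightarrow> real \<Rightarrow> ('a::euclidean_space \<Rightarrow> real) \<Rightarrow> ennreal" where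
  "s1 p \<alpha> f = (INF g\<in>B_p p \<alpha>. norm_B_inf \<alpha> (\<lambda>x. f x - g x))"

definition s2 :: "real \<Rightarrow> ('a::euclidean_space \<Rightarrow> real) \<Rightarrow> ennreal" where
  "s2 \<alpha> f = (INF \<epsilon>\<in>{\<epsilon>. \<epsilon> > 0 \<and>
     (\<integral>\<^sup>+r\<in>{0..<1}. ennreal (indicator (L_set \<epsilon> \<alpha> f) r * inverse (1 - r)) \<partial>lborel) < \<infinity>}. ennreal \<epsilon>)"

end

(*
  By monotonicity of the means M1 f r in r, a point where (1 - r)^alpha M1 f r exceeds
  2^alpha epsilon forces the interval [r, (1 + r)/2] into the level set of epsilon. Such an
  interval has dr/(1 - r)-mass at least 1/2, so if the level set has finite mass then
  (1 - r)^alpha M1 f r <= 2^alpha epsilon for all r near 1. A dilate g x = f (rho x) lies in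
  B^(p,1), and for rho close to 1 it is close to f on compact subsets of the ball, while near
  the boundary f and g both satisfy the bound above; hence s1 <= 2^(alpha+1) s2. Conversely, if
  norm (f - g) <= c, the level set of 2c for f lies in the level set of c for g, whose mass is
  finite by Chebyshev's inequality; hence s2 <= 2 s1.

  Monotonicity of M1 is proved without polar coordinates: for u subharmonic and a radial weight
  w, integration by parts shows that the integral of w(|x|^2) u(t x) increases with t; let w tend
  to the indicator of a thin annulus and u = sqrt (f^2 + eta^2) to |f|.
*)

theory Submission
  imports Defs
begin

section \<open>Integration by parts against a radial weight\<close>

text \<open>Since \<open>sphere_measure\<close> is a pushforward of volume under \<open>sgn\<close>,
  a mean over a sphere is accessible only as a volume integral of a function of
  \<open>sgn x\<close>. Such a function is invariant under dilations, so its integrals over an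
  annulus and over the ball differ only by the ratio of the volumes; uniform continuity near the
  sphere then replaces \<open>sgn x\<close> by x. The root with \<eta> is there because |f| need not
  be differentiable at the zeros of f. Monotonicity of M1 is used in three ways: it thickens a point
  of a level set to an interval, it bounds the means of a dilate and so puts the dilate into
  \<open>B_p\<close>, and it makes M1 Borel in the radius. In the constant 2 * 2^\<alpha>, the power
  is the price of halving the distance to the boundary, and the factor 2 comes from the triangle
  inequality for f and its dilate.\<close>

lemma integral_cbox_eq_lborel:
  fixes h :: "'a::euclidean_space \<Rightarrow> real"
  assumes "continuous_on UNIV h" and "\<And>x. x \<notin> cbox a b \<Longrightarrow> h x = 0"
  shows "integral (cbox a b) h = (\<integral>x. h x \<partial>lborel)"
proof -
  have eq: "(\<lambda>x. indicator (cbox a b) x *\<^sub>R h x) = h"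
    using assms(2) by (auto simp: indicator_def fun_eq_iff)
  have "integrable lborel (\<lambda>x. indicator (cbox a b) x *\<^sub>R h x)"
    by (rule borel_integrable_compact) (auto intro: continuous_on_subset[OF assms(1)])
  then have "integral UNIV h = (\<integral>x. h x \<partial>lborel)"
    unfolding eq by (rule integral_lborel)
  moreover have "integral UNIV (\<lambda>x. if x \<in> cbox a b then h x else 0) = integral (cbox a b) h"
    by (rule integral_restrict_UNIV)
  moreover have "(\<lambda>x. if x \<in> cbox a b then h x else 0) = h"
    using assms(2) by auto
  ultimately show ?thesis by simp
qed

lemma cube_complement_norm:
  fixes x :: "'a::euclidean_space"
  assumes "x \<notin> cbox (- 2 *\<^sub>R One) (2 *\<^sub>R One)"
  shows "norm x > 2"
proof -
  obtain i where "i \<in> Basis" "\<bar>x \<bullet> i\<bar> > 2"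
    using assms by (force simp: mem_box)
  then show ?thesis using Basis_le_norm[of i x] by simp
qed

text \<open>Translating v along b leaves its integral unchanged, so differentiating under the
  integral sign in the translation parameter gives 0. The cube of half-side 2 leaves room for
  translations of length below 1 of a function supported in the unit ball.\<close>

lemma integral_directional_derivative_eq_0:
  fixes v :: "'a::euclidean_space \<Rightarrow> real"
  assumes b: "b \<in> Basis"
    and der: "\<And>x. ((\<lambda>s. v (x + s *\<^sub>R b)) has_real_derivative v' x) (at 0)"
    and contv: "continuous_on UNIV v" and cont: "continuous_on UNIV v'"
    and supp: "\<And>x. norm x > 1 \<Longrightarrow> v x = 0"
  shows "integral (cbox (- 2 *\<^sub>R One) (2 *\<^sub>R One)) v' = 0"
proof -
  define Q :: "'a set" where "Q = cbox (- 2 *\<^sub>R One) (2 *\<^sub>R One)"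
  define F where "F s = integral Q (\<lambda>x. v (x + s *\<^sub>R b))" for s :: real
  have outQ: "norm x > 2" if "x \<notin> Q" for x
    using cube_complement_norm that by (simp only: Q_def)
  have der': "((\<lambda>s. v (x + s *\<^sub>R b)) has_real_derivative v' (x + s *\<^sub>R b)) (at s within U)" for x s U
  proof -
    have "((\<lambda>r. v ((x + s *\<^sub>R b) + (r - s) *\<^sub>R b)) has_real_derivative v' (x + s *\<^sub>R b)) (at s)"
      using DERIV_chain2[OF _ DERIV_diff[OF DERIV_ident DERIV_const], of "\<lambda>q. v ((x + s *\<^sub>R b) + q *\<^sub>R b)" "v' (x + s *\<^sub>R b)" s s UNIV] der[of "x + s *\<^sub>R b"]
      by simp
    then show ?thesis
      by (auto simp: algebra_simps intro: DERIV_subset)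
  qed
  have F: "(F has_real_derivative integral Q (\<lambda>x. v' (x + 0 *\<^sub>R b))) (at 0 within {-1<..<1})"
    unfolding F_def Q_def
  proof (rule leibniz_rule_field_derivative)
    show "continuous_on ({-1<..<1} \<times> cbox (- 2 *\<^sub>R One) (2 *\<^sub>R One)) (\<lambda>(s::real, x). v' (x + s *\<^sub>R b))"
      by (auto simp: split_beta intro!: continuous_intros continuous_on_compose2[OF cont])
    show "(\<lambda>x. v (x + s *\<^sub>R b)) integrable_on cbox (- 2 *\<^sub>R One) (2 *\<^sub>R One)" for s
      by (rule integrable_continuous) (auto intro!: continuous_intros continuous_on_compose2[OF contv])
  qed (auto intro: der')
  \<comment> \<open>The cube integral, needed for the Leibniz rule, is turned into a Lebesgue
    integral over the whole space, which is translation invariant.\<close>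
  have const: "F s = (\<integral>x. v x \<partial>lborel)" if s: "s \<in> {-1<..<1}" for s
  proof -
    have "F s = (\<integral>x. v (x + s *\<^sub>R b) \<partial>lborel)"
      unfolding F_def Q_def
    proof (rule integral_cbox_eq_lborel)
      fix x :: 'a assume "x \<notin> cbox (- 2 *\<^sub>R One) (2 *\<^sub>R One)"
      then have "norm x > 2" using outQ by (simp add: Q_def)
      moreover have "norm x \<le> norm (x + s *\<^sub>R b) + norm (s *\<^sub>R b)"
        by (metis add_diff_cancel_right' norm_triangle_ineq4)
      moreover have "norm (s *\<^sub>R b) < 1" using s b by auto
      ultimately show "v (x + s *\<^sub>R b) = 0" by (intro supp) simp
    qed (auto intro!: continuous_intros continuous_on_compose2[OF contv])
    also have "\<dots> = (\<integral>x. v x \<partial>distr lborel borel ((+) (s *\<^sub>R b)))"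
      using contv by (subst integral_distr) (auto simp: add.commute intro: borel_measurable_continuous_onI)
    finally show ?thesis by (simp add: lborel_distr_plus)
  qed
  have "(F has_real_derivative 0) (at 0 within {-1<..<1})"
    by (rule has_field_derivative_transform_within[OF DERIV_const, of 1]) (auto simp: const)
  then have "integral Q (\<lambda>x. v' (x + 0 *\<^sub>R b)) = 0"
    using F by (auto simp: at_within_open[of 0 "{-1<..<1::real}"] intro: DERIV_unique)
  then show ?thesis by (simp add: Q_def)
qed

text \<open>W is the tail integral of w. Its vanishing from 1 on removes the boundary term in the
  integration by parts, and its sign preserves that of the Laplacian. Starting at -1 makes W
  differentiable from both sides at 0, the value of the squared norm at the origin.\<close>

lemma compactly_supported_antiderivative:
  fixes w :: "real \<Rightarrow> real"
  assumes w: "continuous_on UNIV w" "\<And>s. w s \<ge> 0" "\<And>s. s \<ge> 1 \<Longrightarrow> w s = 0"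
  obtains W where "\<And>s. s > -1 \<Longrightarrow> (W has_real_derivative - w s) (at s)"
    and "\<And>s. s > -1 \<Longrightarrow> W s \<ge> 0" and "\<And>s. s \<ge> 1 \<Longrightarrow> W s = 0"
proof
  let ?W = "\<lambda>s. integral {-1..1} w - integral {-1..s} w"
  have int: "w integrable_on {a..b}" for a b
    using integrable_continuous_interval[OF continuous_on_subset[OF w(1)]] by auto
  show "(?W has_real_derivative - w s) (at s)" if "s > -1" for s
  proof -
    have "((\<lambda>x. integral {-1..x} w) has_real_derivative w s) (at s within {-1..s+1})"
      using that by (intro integral_has_real_derivative continuous_on_subset[OF w(1)]) auto
    then have "((\<lambda>x. integral {-1..x} w) has_real_derivative w s) (at s)"
      using that by (subst (asm) at_within_interior) auto
    then show ?thesis by (auto intro!: derivative_eq_intros)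
  qed
  show zero: "?W s = 0" if "s \<ge> 1" for s
  proof -
    have "integral {1..s} w = 0"
      using w(3) by (intro integral_eq_0_iff[THEN iffD2] integral_unique has_integral_is_0) auto
    moreover have "integral {-1..1} w + integral {1..s} w = integral {-1..s} w"
      using that int by (intro Henstock_Kurzweil_Integration.integral_combine) auto
    ultimately show ?thesis by simp
  qed
  show "?W s \<ge> 0" if "s > -1" for s
  proof (cases "s \<ge> 1")
    case True then show ?thesis using zero by simp
  next
    case False
    then have "integral {-1..s} w \<le> integral {-1..1} w"
      using int w(2) by (intro integral_subset_le) auto
    then show ?thesis by simp
  qed
qed

text \<open>Composing with this retraction makes integrands continuous on a whole cube, although a
  harmonic function is arbitrary outside the ball.\<close>

definition ball_retraction :: "'a::euclidean_space \<Rightarrow> 'a" where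
  "ball_retraction x = x /\<^sub>R max 1 (norm x)"

lemma ball_retraction_eq: "norm x \<le> 1 \<Longrightarrow> ball_retraction x = x"
  by (simp add: ball_retraction_def max_def)

lemma norm_ball_retraction: "norm (ball_retraction x) \<le> 1"
  by (auto simp: ball_retraction_def max_def divide_simps)

lemma continuous_on_ball_retraction: "continuous_on S ball_retraction"
proof -
  have "max 1 (norm x) \<noteq> 0" for x :: 'a by (auto simp: max_def)
  then show ?thesis
    unfolding ball_retraction_def by (intro continuous_intros) auto
qed

lemma norm_scaleR_ball_retraction: "\<bar>t\<bar> < 1 \<Longrightarrow> norm (t *\<^sub>R ball_retraction x) < 1"
  using mult_left_le[OF norm_ball_retraction[of x], of "\<bar>t\<bar>"] by simp

text \<open>G is the gradient of u and the sum of the D b is its Laplacian. Both are parameters so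
  that explicit formulas can be supplied for a composite u. Only the derivative of G b in its own
  direction b is required, as only a divergence is integrated.\<close>

lemma weighted_dilation_mono:
  fixes u :: "'a::euclidean_space \<Rightarrow> real" and G D :: "'a \<Rightarrow> 'a \<Rightarrow> real"
  assumes u: "\<And>x. norm x < 1 \<Longrightarrow> (u has_derivative (\<lambda>h. \<Sum>b\<in>Basis. (h \<bullet> b) * G b x)) (at x)"
    and G: "\<And>b x. b \<in> Basis \<Longrightarrow> norm x < 1 \<Longrightarrow>
      ((\<lambda>s. G b (x + s *\<^sub>R b)) has_real_derivative D b x) (at 0)"
    and contG: "\<And>b. b \<in> Basis \<Longrightarrow> continuous_on (ball 0 1) (G b)"
    and contD: "\<And>b. b \<in> Basis \<Longrightarrow> continuous_on (ball 0 1) (D b)"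
    and sub: "\<And>x. norm x < 1 \<Longrightarrow> (\<Sum>b\<in>Basis. D b x) \<ge> 0"
    and w: "continuous_on UNIV w" "\<And>s. w s \<ge> 0" "\<And>s. s \<ge> 1 \<Longrightarrow> w s = 0"
    and t: "0 \<le> t" "t \<le> t'" "t' < 1"
  shows "integral (cbox (- 2 *\<^sub>R One) (2 *\<^sub>R One)) (\<lambda>x. w ((norm x)\<^sup>2) * u (t *\<^sub>R ball_retraction x))
       \<le> integral (cbox (- 2 *\<^sub>R One) (2 *\<^sub>R One)) (\<lambda>x. w ((norm x)\<^sup>2) * u (t' *\<^sub>R ball_retraction x))"
proof -
  define Q :: "'a set" where "Q = cbox (- 2 *\<^sub>R One) (2 *\<^sub>R One)"
  let ?\<pi> = "ball_retraction :: 'a \<Rightarrow> 'a"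
  define F where "F s = integral Q (\<lambda>x. w ((norm x)\<^sup>2) * u (s *\<^sub>R ?\<pi> x))" for s
  define F' where "F' s x = w ((norm x)\<^sup>2) * (\<Sum>b\<in>Basis. (?\<pi> x \<bullet> b) * G b (s *\<^sub>R ?\<pi> x))" for s x
  have contu: "continuous_on (ball 0 1) u"
    by (rule continuous_at_imp_continuous_on) (auto intro!: has_derivative_continuous[OF u])
  have nrm: "norm (s *\<^sub>R ?\<pi> x) < 1" if "s \<in> {-1<..<1}" for s x
    using that by (intro norm_scaleR_ball_retraction) auto
  have cw: "continuous_on S (\<lambda>x. w ((norm (g x))\<^sup>2))" if "continuous_on S g" for g :: "'b::topological_space \<Rightarrow> 'a" and S
    by (rule continuous_on_compose2[OF w(1)]) (auto intro!: continuous_intros that)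
  have cpi: "continuous_on S (\<lambda>x. ?\<pi> (g x))" if "continuous_on S g" for g :: "'b::topological_space \<Rightarrow> 'a" and S
    by (rule continuous_on_compose2[OF continuous_on_ball_retraction that]) auto
  \<comment> \<open>The open interval (-1, 1), rather than [0, 1), yields a two-sided derivative at
    dilation factor 0 as well.\<close>
  have der: "(F has_real_derivative integral Q (F' s)) (at s)" if s: "s \<in> {-1<..<1}" for s
  proof -
    have "(F has_real_derivative integral Q (F' s)) (at s within {-1<..<1})"
      unfolding F_def Q_def
    proof (rule leibniz_rule_field_derivative)
      fix s x assume s: "s \<in> {-1<..<1::real}"
      have "((\<lambda>s. u (s *\<^sub>R ?\<pi> x)) has_derivative (\<lambda>h. \<Sum>b\<in>Basis. ((h *\<^sub>R ?\<pi> x) \<bullet> b) * G b (s *\<^sub>R ?\<pi> x))) (at s)"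
        by (rule has_derivative_compose[where f = "\<lambda>s. s *\<^sub>R ?\<pi> x" and g = u, OF _ u[OF nrm[OF s]]]) (auto intro!: derivative_eq_intros)
      then have "((\<lambda>s. u (s *\<^sub>R ?\<pi> x)) has_real_derivative (\<Sum>b\<in>Basis. (?\<pi> x \<bullet> b) * G b (s *\<^sub>R ?\<pi> x))) (at s)"
        unfolding has_field_derivative_def
        by (rule has_derivative_eq_rhs) (simp add: fun_eq_iff sum_distrib_right, simp add: mult_ac)
      then show "((\<lambda>s. w ((norm x)\<^sup>2) * u (s *\<^sub>R ?\<pi> x)) has_real_derivative F' s x) (at s within {-1<..<1})"
        unfolding F'_def by (auto intro!: DERIV_cmult intro: DERIV_subset)
    next
      fix s assume s: "s \<in> {-1<..<1::real}"
      show "(\<lambda>x. w ((norm x)\<^sup>2) * u (s *\<^sub>R ?\<pi> x)) integrable_on cbox (- 2 *\<^sub>R One) (2 *\<^sub>R One)"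
        by (intro integrable_continuous continuous_intros cw cpi continuous_on_compose2[OF contu])
           (auto simp del: norm_scaleR simp: nrm[OF s])
    next
      show "continuous_on ({-1<..<1} \<times> cbox (- 2 *\<^sub>R One) (2 *\<^sub>R One)) (\<lambda>(s, x). F' s x)"
        unfolding F'_def split_beta
      proof (rule continuous_on_mult[OF cw[OF continuous_on_snd[OF continuous_on_id]] continuous_on_sum])
        let ?S = "{-1<..<1::real} \<times> cbox (- 2 *\<^sub>R One) (2 *\<^sub>R One :: 'a)"
        fix b :: 'a assume b: "b \<in> Basis"
        have c: "continuous_on ?S (\<lambda>p. ?\<pi> (snd p))"
          by (rule cpi[OF continuous_on_snd[OF continuous_on_id]])
        have "continuous_on ?S (\<lambda>p. G b (fst p *\<^sub>R ?\<pi> (snd p)))"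
          by (rule continuous_on_compose2[OF contG[OF b] continuous_on_scaleR[OF continuous_on_fst[OF continuous_on_id] c]])
             (auto simp del: norm_scaleR simp: nrm)
        then show "continuous_on ?S (\<lambda>p. ?\<pi> (snd p) \<bullet> b * G b (fst p *\<^sub>R ?\<pi> (snd p)))"
          by (rule continuous_on_mult[OF continuous_on_inner[OF c continuous_on_const]])
      qed
    qed (use s in auto)
    then show ?thesis by (simp only: at_within_open[OF s open_greaterThanLessThan])
  qed
  obtain W where W: "\<And>s. s > -1 \<Longrightarrow> (W has_real_derivative - w s) (at s)"
    "\<And>s. s > -1 \<Longrightarrow> W s \<ge> 0" "\<And>s. s \<ge> 1 \<Longrightarrow> W s = 0"
    using compactly_supported_antiderivative[OF w] by blast
  have sq: "-1 < (norm x)\<^sup>2" for x :: 'a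
    by (rule less_le_trans[OF _ zero_le_power2]) simp
  have contW: "continuous_on {0..} W"
    by (rule continuous_at_imp_continuous_on) (auto intro!: DERIV_isCont[OF W(1)])
  have cW: "continuous_on S (\<lambda>x. W ((norm (g x))\<^sup>2))" if "continuous_on S g" for g :: "'b::topological_space \<Rightarrow> 'a" and S
    by (rule continuous_on_compose2[OF contW]) (auto intro!: continuous_intros that)
  \<comment> \<open>The derivative is \<open>\<integral> w(\<bar>x\<bar>\<^sup>2) x \<bullet> \<nabla>u(s x)\<close>; as the divergence of \<open>W(\<bar>x\<bar>\<^sup>2) \<nabla>u(s x)\<close> has integral \<open>0\<close>,
    it equals \<open>s/2 \<integral> W(\<bar>x\<bar>\<^sup>2) \<Delta>u(s x)\<close>.\<close>
  have nonneg: "integral Q (F' s) \<ge> 0" if s: "0 \<le> s" "s < 1" for s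
  proof -
    have s': "norm (s *\<^sub>R ?\<pi> x) < 1" for x by (rule nrm) (use s in auto)
    define v where "v b x = W ((norm x)\<^sup>2) * G b (s *\<^sub>R ?\<pi> x)" for b x
    define v1 where "v1 b x = w ((norm x)\<^sup>2) * ((?\<pi> x \<bullet> b) * G b (s *\<^sub>R ?\<pi> x))" for b x
    define v2 where "v2 b x = W ((norm x)\<^sup>2) * D b (s *\<^sub>R ?\<pi> x)" for b x
    have cv1: "continuous_on UNIV (v1 b)" and cv2: "continuous_on UNIV (v2 b)" and cv: "continuous_on UNIV (v b)"
      if "b \<in> Basis" for b unfolding v1_def v2_def v_def using that
      by (auto intro!: continuous_intros cw cW cpi continuous_on_compose2[OF contG] continuous_on_compose2[OF contD]
          simp del: norm_scaleR simp: s')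
    have i1: "v1 b integrable_on Q" and i2: "v2 b integrable_on Q" if "b \<in> Basis" for b
      unfolding Q_def using cv1[OF that] cv2[OF that]
      by (auto intro!: integrable_continuous intro: continuous_on_subset)
    have eq: "integral Q (v1 b) * 2 = s * integral Q (v2 b)" if b: "b \<in> Basis" for b
    proof -
      have "integral (cbox (- 2 *\<^sub>R One) (2 *\<^sub>R One)) (\<lambda>x. s * v2 b x - 2 * v1 b x) = 0"
      proof (rule integral_directional_derivative_eq_0[OF b _ cv[OF b]])
        fix x :: 'a
        show "((\<lambda>r. v b (x + r *\<^sub>R b)) has_real_derivative (s * v2 b x - 2 * v1 b x)) (at 0)"
        proof (cases "norm x > 1")
          case True
          have "((\<lambda>r. norm (x + r *\<^sub>R b)) \<longlongrightarrow> norm (x + 0 *\<^sub>R b)) (at 0)"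
            by (intro tendsto_intros)
          then have "\<forall>\<^sub>F r in at 0. norm (x + r *\<^sub>R b) > 1"
            using True by (auto dest: order_tendstoD)
          then have ev: "\<forall>\<^sub>F r in at 0. v b (x + r *\<^sub>R b) = 0"
            by eventually_elim (simp add: v_def W(3))
          have z: "v b x = 0" "v1 b x = 0" "v2 b x = 0" using True
            by (auto simp: v_def v1_def v2_def W(3) w(3))
          show ?thesis unfolding z
            using has_field_derivative_cong_eventually[OF ev] z by simp
        next
          case False
          then have px: "?\<pi> x = x" by (simp add: ball_retraction_eq)
          have sx: "norm (s *\<^sub>R x) < 1" using s'[of x] px by simp
          have d1: "((\<lambda>r. (norm (x + r *\<^sub>R b))\<^sup>2) has_real_derivative 2 * (x \<bullet> b)) (at 0)"
            unfolding power2_norm_eq_inner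
            by (auto intro!: derivative_eq_intros simp: inner_commute has_field_derivative_def)
          have d2: "((\<lambda>r. W ((norm (x + r *\<^sub>R b))\<^sup>2)) has_real_derivative - w ((norm x)\<^sup>2) * (2 * (x \<bullet> b))) (at 0)"
            by (rule DERIV_chain2[OF _ d1]) (use W(1)[OF sq] in simp)
          have lin: "((\<lambda>r. s * r) has_real_derivative s) (at 0)"
            using DERIV_cmult[OF DERIV_ident, of s] by simp
          have d3: "((\<lambda>r. G b (s *\<^sub>R (x + r *\<^sub>R b))) has_real_derivative D b (s *\<^sub>R x) * s) (at 0)"
            using DERIV_chain2[of "\<lambda>q. G b (s *\<^sub>R x + q *\<^sub>R b)" "D b (s *\<^sub>R x)" "\<lambda>r. s * r" 0 s UNIV, OF _ lin] G[OF b sx]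
            by (simp add: algebra_simps)
          have d4: "((\<lambda>r. W ((norm (x + r *\<^sub>R b))\<^sup>2) * G b (s *\<^sub>R (x + r *\<^sub>R b))) has_real_derivative (s * v2 b x - 2 * v1 b x)) (at 0)"
            using DERIV_mult[OF d2 d3] by (simp add: v1_def v2_def px algebra_simps)
          \<comment> \<open>For x on the unit sphere, \<open>x + r *\<^sub>R b\<close> may leave the
            closed ball, where the retraction is no longer the identity. There W vanishes, so the
            products with and without retraction agree everywhere.\<close>
          have "W ((norm y)\<^sup>2) * G b (s *\<^sub>R y) = v b y" for y
          proof (cases "norm y \<le> 1")
            case False
            then have "1 \<le> (norm y)\<^sup>2" by auto
            then show ?thesis by (simp add: v_def W(3))
          qed (simp add: v_def ball_retraction_eq)
          then show ?thesis using d4 by simp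
        qed
      qed (auto intro!: continuous_intros cv1 cv2 b simp: v_def W(3))
      then have "integral Q (\<lambda>x. s * v2 b x - 2 * v1 b x) = 0"
        by (simp only: Q_def)
      moreover have "integral Q (\<lambda>x. s * v2 b x - 2 * v1 b x) = s * integral Q (v2 b) - 2 * integral Q (v1 b)"
        using integrable_cmul[OF i1[OF b], of 2] integrable_cmul[OF i2[OF b], of s]
        by (subst integral_diff) auto
      ultimately show ?thesis by simp
    qed
    have "F' s = (\<lambda>x. \<Sum>b\<in>Basis. v1 b x)"
      by (simp add: fun_eq_iff F'_def v1_def sum_distrib_left)
    then have "integral Q (F' s) = (\<Sum>b\<in>Basis. integral Q (v1 b))"
      by (simp add: integral_sum i1)
    also have "\<dots> = s / 2 * (\<Sum>b\<in>Basis. integral Q (v2 b))"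
      using eq by (auto simp: sum_distrib_left intro!: sum.cong)
    also have "(\<Sum>b\<in>Basis. integral Q (v2 b)) = integral Q (\<lambda>x. \<Sum>b\<in>Basis. v2 b x)"
      by (rule integral_sum[symmetric]) (auto simp: i2)
    finally have "integral Q (F' s) = s / 2 * integral Q (\<lambda>x. \<Sum>b\<in>Basis. v2 b x)" .
    moreover have "integral Q (\<lambda>x. \<Sum>b\<in>Basis. v2 b x) \<ge> 0"
    proof (rule integral_nonneg)
      show "(\<lambda>x. \<Sum>b\<in>Basis. v2 b x) integrable_on Q" by (auto intro!: integrable_sum i2)
      show "(\<Sum>b\<in>Basis. v2 b x) \<ge> 0" for x
        unfolding v2_def sum_distrib_left[symmetric]
        by (intro mult_nonneg_nonneg sub s' W(2) sq)
    qed
    ultimately show ?thesis using s(1) by (simp only: mult_nonneg_nonneg divide_nonneg_pos zero_less_numeral)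
  qed
  have "F t \<le> F t'"
  proof (rule DERIV_nonneg_imp_nondecreasing[OF t(2)])
    fix s assume "t \<le> s" "s \<le> t'"
    then have "(F has_real_derivative integral Q (F' s)) (at s)" "0 \<le> integral Q (F' s)"
      using t by (auto intro: der nonneg)
    then show "\<exists>y. (F has_real_derivative y) (at s) \<and> 0 \<le> y" by blast
  qed
  then show ?thesis by (simp add: F_def Q_def)
qed

section \<open>Subharmonicity of the absolute value\<close>

lemma has_derivative_partial_derivatives:
  fixes f :: "'a::euclidean_space \<Rightarrow> real"
  assumes "f differentiable (at x)"
  shows "(f has_derivative (\<lambda>h. \<Sum>b\<in>Basis. (h \<bullet> b) * partial_derivative f b x)) (at x)"
proof -
  let ?f' = "frechet_derivative f (at x)"
  have d: "(f has_derivative ?f') (at x)"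
    using assms by (simp add: frechet_derivative_works)
  then have lin: "linear ?f'" by (rule has_derivative_linear)
  have "?f' h = (\<Sum>b\<in>Basis. (h \<bullet> b) * partial_derivative f b x)" for h
  proof -
    have "?f' h = ?f' (\<Sum>b\<in>Basis. (h \<bullet> b) *\<^sub>R b)"
      by (simp add: euclidean_representation)
    also have "\<dots> = (\<Sum>b\<in>Basis. (h \<bullet> b) * partial_derivative f b x)"
      by (simp add: linear_sum[OF lin] linear_cmul[OF lin] partial_derivative_def)
    finally show ?thesis .
  qed
  then show ?thesis using d by presburger
qed

lemma has_real_derivative_along_partial_derivative:
  fixes f :: "'a::euclidean_space \<Rightarrow> real"
  assumes "f differentiable (at x)"
  shows "((\<lambda>s. f (x + s *\<^sub>R b)) has_real_derivative partial_derivative f b x) (at 0)"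
proof -
  let ?f' = "frechet_derivative f (at x)"
  have d: "(f has_derivative ?f') (at (x + 0 *\<^sub>R b))"
    using assms by (simp add: frechet_derivative_works)
  then have lin: "linear ?f'" by (rule has_derivative_linear)
  have "((\<lambda>s. f (x + s *\<^sub>R b)) has_derivative (\<lambda>s. ?f' (s *\<^sub>R b))) (at 0)"
    by (rule has_derivative_compose[where f = "\<lambda>s. x + s *\<^sub>R b" and g = f, OF _ d]) (auto intro!: derivative_eq_intros)
  then show ?thesis
    unfolding has_field_derivative_def partial_derivative_def
    by (rule has_derivative_eq_rhs) (simp add: fun_eq_iff linear_cmul[OF lin])
qed

lemma C2_on_ballD:
  fixes f :: "'a::euclidean_space \<Rightarrow> real"
  assumes "C2_on (ball 0 1) f" and "norm x < 1" and "b \<in> Basis"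
  shows "f differentiable (at x)" "partial_derivative f b differentiable (at x)"
  using assms by (auto simp: C2_on_def differentiable_on_eq_differentiable_at)

lemma C2_on_ball_continuous:
  fixes f :: "'a::euclidean_space \<Rightarrow> real"
  assumes "C2_on (ball 0 1) f"
  shows "continuous_on (ball 0 1) f"
  using assms by (auto simp: C2_on_def intro: differentiable_imp_continuous_on)

lemma continuous_on_dilated_retraction:
  fixes f :: "'a::euclidean_space \<Rightarrow> real"
  assumes "continuous_on (ball 0 1) f" and "\<bar>t\<bar> < 1"
  shows "continuous_on S (\<lambda>x. f (t *\<^sub>R ball_retraction x))"
  by (rule continuous_on_compose2[OF assms(1)])
     (auto intro!: continuous_intros continuous_on_ball_retraction simp del: norm_scaleR
       simp: norm_scaleR_ball_retraction assms(2))

text \<open>\<open>sqrt (f\<^sup>2 + \<eta>\<^sup>2)\<close> is a smooth subharmonic approximation of \<open>\<bar>f\<bar>\<close>.\<close>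

lemma weighted_dilation_mono_sqrt:
  fixes f :: "'a::euclidean_space \<Rightarrow> real"
  assumes f: "f \<in> harmonic_on_ball" and \<eta>: "\<eta> > 0"
    and w: "continuous_on UNIV w" "\<And>s. w s \<ge> 0" "\<And>s. s \<ge> 1 \<Longrightarrow> w s = 0"
    and t: "0 \<le> t" "t \<le> t'" "t' < 1"
  shows "integral (cbox (- 2 *\<^sub>R One) (2 *\<^sub>R One)) (\<lambda>x. w ((norm x)\<^sup>2) * sqrt ((f (t *\<^sub>R ball_retraction x))\<^sup>2 + \<eta>\<^sup>2))
       \<le> integral (cbox (- 2 *\<^sub>R One) (2 *\<^sub>R One)) (\<lambda>x. w ((norm x)\<^sup>2) * sqrt ((f (t' *\<^sub>R ball_retraction x))\<^sup>2 + \<eta>\<^sup>2))"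
proof -
  have C2: "C2_on (ball 0 1) f" using f by (simp add: harmonic_on_ball_def)
  define p where "p = partial_derivative f"
  define p2 where "p2 b = partial_derivative (p b) b" for b
  define u where "u x = sqrt ((f x)\<^sup>2 + \<eta>\<^sup>2)" for x
  have pos: "u x > 0" for x using \<eta> by (simp add: u_def add_nonneg_pos)
  have u2: "(u x)\<^sup>2 = (f x)\<^sup>2 + \<eta>\<^sup>2" for x by (simp add: u_def)
  have contf: "continuous_on (ball 0 1) f" by (rule C2_on_ball_continuous[OF C2])
  have contu: "continuous_on (ball 0 1) u"
    unfolding u_def by (intro continuous_intros contf)
  have contp: "continuous_on (ball 0 1) (p b)" if "b \<in> Basis" for b
    using C2 that by (auto simp: C2_on_def p_def intro: differentiable_imp_continuous_on)
  have contp2: "continuous_on (ball 0 1) (p2 b)" if "b \<in> Basis" for b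
    using C2 that by (auto simp: C2_on_def p_def p2_def)
  have nz: "u x \<noteq> 0" for x using pos[of x] by simp
  \<comment> \<open>This is the quotient rule for f * p b / u in direction b, using that u itself
    has the derivative f * p b / u there.\<close>
  let ?D = "\<lambda>b x. ((p b x)\<^sup>2 + f x * p2 b x) / u x - (f x * p b x)\<^sup>2 / (u x) ^ 3"
  have q: "((\<lambda>y. sqrt (y\<^sup>2 + \<eta>\<^sup>2)) has_real_derivative f x / u x) (at (f x))" for x
  proof -
    have pos: "(f x)\<^sup>2 + \<eta>\<^sup>2 > 0" using \<eta> by (simp add: add_nonneg_pos)
    have d: "((\<lambda>y. y\<^sup>2 + \<eta>\<^sup>2) has_real_derivative 2 * f x) (at (f x))"
      by (auto intro!: derivative_eq_intros)
    have "((\<lambda>y. sqrt (y\<^sup>2 + \<eta>\<^sup>2)) has_real_derivative inverse (u x) / 2 * (2 * f x)) (at (f x))"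
      using DERIV_chain2[OF DERIV_real_sqrt[OF pos] d] by (simp only: u_def)
    moreover have "inverse (u x) / 2 * (2 * f x) = f x / u x"
      by (simp add: field_simps)
    ultimately show ?thesis by (simp only:)
  qed
  have along: "((\<lambda>s. u (x + s *\<^sub>R b)) has_real_derivative f x / u x * p b x) (at 0)"
    if "b \<in> Basis" "norm x < 1" for b x
    unfolding u_def[of "x + s *\<^sub>R b" for s] p_def
    by (rule DERIV_chain2[of "\<lambda>y. sqrt (y\<^sup>2 + \<eta>\<^sup>2)"])
       (use q[of x] has_real_derivative_along_partial_derivative[OF C2_on_ballD(1)[OF C2 that(2,1)]] in auto)
  have "integral (cbox (- 2 *\<^sub>R One) (2 *\<^sub>R One)) (\<lambda>x. w ((norm x)\<^sup>2) * u (t *\<^sub>R ball_retraction x))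
       \<le> integral (cbox (- 2 *\<^sub>R One) (2 *\<^sub>R One)) (\<lambda>x. w ((norm x)\<^sup>2) * u (t' *\<^sub>R ball_retraction x))"
  proof (rule weighted_dilation_mono[where G = "\<lambda>b x. f x * p b x / u x" and D = ?D, OF _ _ _ _ _ w t])
    fix x :: 'a assume x: "norm x < 1"
    obtain b0 :: 'a where b0: "b0 \<in> Basis" using nonempty_Basis by blast
    note d = has_derivative_partial_derivatives[OF C2_on_ballD(1)[OF C2 x b0]]
    have "(u has_derivative (\<lambda>h. f x / u x * (\<Sum>b\<in>Basis. (h \<bullet> b) * p b x))) (at x)"
      using has_derivative_compose[OF d q[unfolded has_field_derivative_def]]
      by (simp add: u_def[abs_def] p_def)
    then show "(u has_derivative (\<lambda>h. \<Sum>b\<in>Basis. (h \<bullet> b) * (f x * p b x / u x))) (at x)"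
      by (rule has_derivative_eq_rhs) (simp add: fun_eq_iff sum_distrib_left mult_ac)
    \<comment> \<open>Over the denominator u^3 the terms with the square of p b combine to the
      factor u^2 - f^2 = \<eta>^2, which is nonnegative. What is left sums to a multiple of the
      Laplacian of f.\<close>
    have "(\<Sum>b\<in>Basis. ?D b x) = (\<Sum>b\<in>Basis. f x / u x * p2 b x + (p b x)\<^sup>2 * \<eta>\<^sup>2 / (u x) ^ 3)"
    proof (rule sum.cong)
      fix b :: 'a
      have "?D b x = f x / u x * p2 b x + (p b x)\<^sup>2 * ((u x)\<^sup>2 - (f x)\<^sup>2) / (u x) ^ 3"
        using nz[of x] by (simp add: field_simps power2_eq_square power3_eq_cube)
      then show "?D b x = f x / u x * p2 b x + (p b x)\<^sup>2 * \<eta>\<^sup>2 / (u x) ^ 3" by (simp add: u2)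
    qed simp
    also have "\<dots> = f x / u x * laplacian f x + (\<Sum>b\<in>Basis. (p b x)\<^sup>2 * \<eta>\<^sup>2 / (u x) ^ 3)"
      by (simp add: sum.distrib sum_distrib_left laplacian_def p2_def p_def)
    also have "laplacian f x = 0" using f x by (simp add: harmonic_on_ball_def)
    finally show "(\<Sum>b\<in>Basis. ?D b x) \<ge> 0"
      using pos[of x] by (auto intro!: sum_nonneg)
  next
    fix b x :: 'a assume b: "b \<in> Basis" and x: "norm x < 1"
    have [derivative_intros]: "((\<lambda>s. f (x + s *\<^sub>R b)) has_real_derivative p b x) (at 0)"
      "((\<lambda>s. p b (x + s *\<^sub>R b)) has_real_derivative p2 b x) (at 0)"
      unfolding p_def p2_def
      by (intro has_real_derivative_along_partial_derivative C2_on_ballD[OF C2 x b])+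
    note [derivative_intros] = along[OF b x]
    show "((\<lambda>s. f (x + s *\<^sub>R b) * p b (x + s *\<^sub>R b) / u (x + s *\<^sub>R b)) has_real_derivative ?D b x) (at 0)"
      using nz[of x]
      by (auto intro!: derivative_eq_intros simp: field_simps power2_eq_square power3_eq_cube)
  next
    fix b :: 'a assume b: "b \<in> Basis"
    show "continuous_on (ball 0 1) (\<lambda>x. f x * p b x / u x)"
      by (intro continuous_intros contf contp contu b) (simp add: nz)
    show "continuous_on (ball 0 1) (?D b)"
      by (intro continuous_intros contf contp contp2 contu b) (simp_all add: nz)
  qed
  then show ?thesis by (simp add: u_def)
qed

section \<open>From continuous radial weights to annuli, and from the smooth root to the absolute
  value\<close>

lemma dilated_retraction_bounded:
  fixes f :: "'a::euclidean_space \<Rightarrow> real"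
  assumes "continuous_on (ball 0 1) f" and "\<bar>t\<bar> < 1"
  obtains B where "\<And>x. \<bar>f (t *\<^sub>R ball_retraction x)\<bar> \<le> B"
proof -
  have "compact ((\<lambda>x. f (t *\<^sub>R ball_retraction x)) ` cball 0 1)"
    by (intro compact_continuous_image continuous_on_dilated_retraction assms) auto
  then obtain B where "\<And>x. norm x \<le> 1 \<Longrightarrow> \<bar>f (t *\<^sub>R ball_retraction x)\<bar> \<le> B"
    using compact_imp_bounded by (fastforce simp: bounded_iff)
  \<comment> \<open>The retraction is idempotent, so every value is already attained on the compact
    unit ball.\<close>
  from this[OF norm_ball_retraction] have "\<bar>f (t *\<^sub>R ball_retraction x)\<bar> \<le> B" for x
    by (simp only: ball_retraction_eq[OF norm_ball_retraction])
  then show thesis by (rule that)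
qed

lemma integrable_indicator_ball:
  fixes g :: "'a::euclidean_space \<Rightarrow> real"
  assumes A: "A \<in> sets borel" "A \<subseteq> ball 0 1"
    and g: "g \<in> borel_measurable borel" "\<And>x. \<bar>g x\<bar> \<le> c"
  shows "integrable lborel (\<lambda>x. indicator A x * g x)"
proof (rule Bochner_Integration.integrable_bound)
  show "integrable lborel (\<lambda>x::'a. indicator (ball 0 1) x * c)"
    using emeasure_lborel_ball_finite[of "0::'a" 1]
    by (intro integrable_mult_left integrable_real_indicator) auto
  show "AE x in lborel. norm (indicator A x * g x) \<le> norm (indicator (ball 0 1) x * c :: real)"
    using A(2) g(2) by (auto simp: indicator_def intro!: AE_I2 order_trans[OF _ abs_ge_self])
  show "(\<lambda>x. indicator A x * g x) \<in> borel_measurable lborel"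
    using A(1) g(1) by measurable
qed

lemma annulus_cutoffs:
  obtains w :: "nat \<Rightarrow> real \<Rightarrow> real"
  where "\<And>j. continuous_on UNIV (w j)" and "\<And>j s. 0 \<le> w j s" and "\<And>j s. w j s \<le> 1"
    and "\<And>j s. s \<ge> 1 \<Longrightarrow> w j s = 0"
    and "\<And>x::'a::real_normed_vector.
      (\<lambda>j. w j ((norm x)\<^sup>2)) \<longlonglongrightarrow> indicator {x. \<rho> \<le> norm x \<and> norm x < 1} x"
proof -
  \<comment> \<open>Negative \<rho> is allowed and gives the whole open ball; the maximum with 0
    prevents squaring from turning it into a positive inner radius.\<close>
  define \<sigma> where "\<sigma> = (max \<rho> 0)\<^sup>2"
  \<comment> \<open>The inner ramp rises below \<sigma> and has reached 1 at \<sigma>, while the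
    outer ramp descends to 0 at 1. Hence the limit contains the inner sphere but not the outer one,
    and every weight vanishes from 1 on.\<close>
  define w where "w j s = max 0 (min 1 (min (1 + real j * (s - \<sigma>)) (real j * (1 - s))))" for j :: nat and s
  have w1: "continuous_on UNIV (w j)" for j unfolding w_def by (intro continuous_intros)
  have w2: "0 \<le> w j s" "w j s \<le> 1" for j s by (simp_all add: w_def)
  have w0: "w j s = 0" if "s \<ge> 1" for j s
  proof -
    have "real j * (1 - s) \<le> 0" using that by (intro mult_nonneg_nonpos) auto
    then show ?thesis by (auto simp: w_def)
  qed
  have wlim: "(\<lambda>j. w j ((norm x)\<^sup>2)) \<longlonglongrightarrow> indicator {x. \<rho> \<le> norm x \<and> norm x < 1} x"
    for x :: 'a
  proof -
    let ?s = "(norm x)\<^sup>2"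
    consider "norm x \<ge> 1" | "norm x < 1" "norm x < \<rho>" | "norm x < 1" "norm x \<ge> \<rho>" by linarith
    then show ?thesis
    proof cases
      case 1
      then have "?s \<ge> 1" by simp
      from w0[OF this] show ?thesis using 1 by simp
    next
      case 2
      then have lt: "?s < \<sigma>" unfolding \<sigma>_def by (intro power_strict_mono) auto
      have "\<forall>\<^sub>F j in sequentially. real j \<ge> 1 / (\<sigma> - ?s)"
        using filterlim_real_sequentially by (auto simp: filterlim_at_top)
      then have "\<forall>\<^sub>F j in sequentially. w j ?s = 0"
      proof eventually_elim
        case (elim j)
        then have "1 + real j * (?s - \<sigma>) \<le> 0" using lt by (simp add: field_simps)
        then show ?case by (auto simp: w_def)
      qed
      then show ?thesis using 2 by (simp add: tendsto_eventually)
    next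
      case 3
      then have lt: "?s < 1" by (simp add: power_less_one_iff abs_square_less_1)
      have ge: "?s \<ge> \<sigma>" unfolding \<sigma>_def using 3 by (intro power_mono) auto
      have "\<forall>\<^sub>F j in sequentially. real j \<ge> 1 / (1 - ?s)"
        using filterlim_real_sequentially by (auto simp: filterlim_at_top)
      then have "\<forall>\<^sub>F j in sequentially. w j ?s = 1"
      proof eventually_elim
        case (elim j)
        then have "real j * (1 - ?s) \<ge> 1" using lt by (simp add: field_simps)
        moreover have "real j * (?s - \<sigma>) \<ge> 0" using ge by simp
        ultimately show ?case by (simp add: w_def)
      qed
      then show ?thesis using 3 by (simp add: tendsto_eventually)
    qed
  qed
  show thesis by (rule that[OF w1 w2 w0 wlim])
qed

lemma tendsto_integral_cube_weights:
  fixes U :: "'a::euclidean_space \<Rightarrow> real"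
  assumes w: "\<And>j. continuous_on UNIV (w j)" "\<And>j s. 0 \<le> w j s" "\<And>j s. w j s \<le> 1"
      "\<And>j s. s \<ge> 1 \<Longrightarrow> w j s = 0"
    and wlim: "\<And>x::'a. (\<lambda>j. w j ((norm x)\<^sup>2)) \<longlonglongrightarrow> indicator A x"
    and A: "A \<in> sets borel" and U: "continuous_on UNIV U" and bound: "\<And>x. \<bar>U x\<bar> \<le> B"
  shows "(\<lambda>j. integral (cbox (- 2 *\<^sub>R One) (2 *\<^sub>R One)) (\<lambda>x. w j ((norm x)\<^sup>2) * U x))
    \<longlonglongrightarrow> (\<integral>x. indicator A x * U x \<partial>lborel)"
proof -
  define Q :: "'a set" where "Q = cbox (- 2 *\<^sub>R One) (2 *\<^sub>R One)"
  have w0: "w j ((norm x)\<^sup>2) = 0" if "x \<notin> Q" for j x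
  proof -
    have "norm x \<ge> 1" using cube_complement_norm[of x] that by (simp add: Q_def)
    then show ?thesis by (intro w(4)) simp
  qed
  have cont: "continuous_on UNIV (\<lambda>x::'a. w j ((norm x)\<^sup>2) * U x)" for j
    by (intro continuous_intros U continuous_on_compose2[OF w(1)]) auto
  have eq: "integral Q (\<lambda>x. w j ((norm x)\<^sup>2) * U x) = (\<integral>x. w j ((norm x)\<^sup>2) * U x \<partial>lborel)" for j
    unfolding Q_def by (rule integral_cbox_eq_lborel[OF cont]) (simp add: w0 Q_def)
  have "(\<lambda>j. \<integral>x. w j ((norm x)\<^sup>2) * U x \<partial>lborel) \<longlonglongrightarrow> (\<integral>x. indicator A x * U x \<partial>lborel)"
  proof (rule integral_dominated_convergence)
    show "integrable lborel (\<lambda>x. indicator Q x * B)"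
      unfolding Q_def
      by (intro integrable_mult_left integrable_real_indicator)
         (auto simp: emeasure_lborel_cbox_finite less_top[symmetric])
    show "(\<lambda>x. indicator A x * U x) \<in> borel_measurable lborel"
      using borel_measurable_continuous_onI[OF U] A by measurable
    show "(\<lambda>x. w j ((norm x)\<^sup>2) * U x) \<in> borel_measurable lborel" for j
      using borel_measurable_continuous_onI[OF cont] by simp
    show "AE x in lborel. (\<lambda>j. w j ((norm x)\<^sup>2) * U x) \<longlonglongrightarrow> indicator A x * U x"
      by (intro AE_I2 tendsto_intros wlim)
    show "AE x in lborel. norm (w j ((norm x)\<^sup>2) * U x) \<le> indicator Q x * B" for j
    proof (intro AE_I2)
      fix x :: 'a
      have "w j ((norm x)\<^sup>2) \<le> indicator Q x"
        using w(3) w0 by (cases "x \<in> Q") auto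
      then show "norm (w j ((norm x)\<^sup>2) * U x) \<le> indicator Q x * B"
        using bound[of x] w(2) by (auto simp: abs_mult intro!: mult_mono)
    qed
  qed
  then show ?thesis by (simp only: eq[symmetric] Q_def)
qed

lemma annulus_dilation_mono_sqrt:
  fixes f :: "'a::euclidean_space \<Rightarrow> real"
  assumes f: "f \<in> harmonic_on_ball" and t: "0 \<le> t" "t \<le> t'" "t' < 1" and \<eta>: "\<eta> > 0"
  shows "(\<integral>x. indicator {x. \<rho> \<le> norm x \<and> norm x < 1} x * sqrt ((f (t *\<^sub>R ball_retraction x))\<^sup>2 + \<eta>\<^sup>2) \<partial>lborel)
    \<le> (\<integral>x. indicator {x. \<rho> \<le> norm x \<and> norm x < 1} x * sqrt ((f (t' *\<^sub>R ball_retraction x))\<^sup>2 + \<eta>\<^sup>2) \<partial>lborel)"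
proof -
  have contf: "continuous_on (ball 0 1) f"
    using f by (simp add: harmonic_on_ball_def C2_on_ball_continuous)
  obtain w :: "nat \<Rightarrow> real \<Rightarrow> real"
    where w: "\<And>j. continuous_on UNIV (w j)" "\<And>j s. 0 \<le> w j s" "\<And>j s. w j s \<le> 1"
      "\<And>j s. s \<ge> 1 \<Longrightarrow> w j s = 0"
    and wlim: "\<And>x::'a. (\<lambda>j. w j ((norm x)\<^sup>2)) \<longlonglongrightarrow> indicator {x. \<rho> \<le> norm x \<and> norm x < 1} x"
    using annulus_cutoffs[of \<rho>] by blast
  define U where "U s x = sqrt ((f (s *\<^sub>R ball_retraction x))\<^sup>2 + \<eta>\<^sup>2)" for s x
  have lim: "(\<lambda>j. integral (cbox (- 2 *\<^sub>R One) (2 *\<^sub>R One)) (\<lambda>x. w j ((norm x)\<^sup>2) * U s x))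
      \<longlonglongrightarrow> (\<integral>x. indicator {x. \<rho> \<le> norm x \<and> norm x < 1} x * U s x \<partial>lborel)"
    if s: "\<bar>s\<bar> < 1" for s
  proof -
    obtain B where B: "\<And>x. \<bar>f (s *\<^sub>R ball_retraction x)\<bar> \<le> B"
      using dilated_retraction_bounded[OF contf s] by blast
    have "\<bar>U s x\<bar> \<le> B + \<eta>" for x
      unfolding U_def using sqrt_sum_squares_le_sum_abs[of "f (s *\<^sub>R ball_retraction x)" \<eta>] B[of x] \<eta> by simp
    then show ?thesis
      by (intro tendsto_integral_cube_weights[OF w wlim])
         (auto simp: U_def intro!: continuous_intros continuous_on_dilated_retraction contf s)
  qed
  have le: "integral (cbox (- 2 *\<^sub>R One) (2 *\<^sub>R One)) (\<lambda>x. w j ((norm x)\<^sup>2) * U t x)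
    \<le> integral (cbox (- 2 *\<^sub>R One) (2 *\<^sub>R One)) (\<lambda>x. w j ((norm x)\<^sup>2) * U t' x)" for j
    unfolding U_def by (rule weighted_dilation_mono_sqrt[OF f \<eta> w(1) w(2) w(4) t])
  have "\<bar>t\<bar> < 1" "\<bar>t'\<bar> < 1" using t by auto
  then show ?thesis
    using LIMSEQ_le[OF lim[of t] lim[of t']] le unfolding U_def by blast
qed

text \<open>The root exceeds |f| by at most \<eta> everywhere, so removing it costs at most \<eta>
  times the volume of the annulus, without a further limit theorem.\<close>

lemma annulus_dilation_mono:
  fixes f :: "'a::euclidean_space \<Rightarrow> real"
  assumes f: "f \<in> harmonic_on_ball" and t: "0 \<le> t" "t \<le> t'" "t' < 1"
  shows "(\<integral>x. indicator {x. \<rho> \<le> norm x \<and> norm x < 1} x * \<bar>f (t *\<^sub>R ball_retraction x)\<bar> \<partial>lborel)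
       \<le> (\<integral>x. indicator {x. \<rho> \<le> norm x \<and> norm x < 1} x * \<bar>f (t' *\<^sub>R ball_retraction x)\<bar> \<partial>lborel)"
    (is "?I t \<le> ?I t'")
proof (rule field_le_epsilon)
  fix e :: real assume e: "e > 0"
  have contf: "continuous_on (ball 0 1) f"
    using f by (simp add: harmonic_on_ball_def C2_on_ball_continuous)
  define A :: "'a set" where "A = {x. \<rho> \<le> norm x \<and> norm x < 1}"
  have A: "A \<in> sets borel" "A \<subseteq> ball 0 1" unfolding A_def by (measurable, auto)
  define m where "m = (\<integral>x. indicator A x * (1::real) \<partial>lborel)"
  have m: "m \<ge> 0" unfolding m_def by (rule integral_nonneg_AE) auto
  \<comment> \<open>The summand 1 covers an annulus of volume 0, which occurs for \<rho> \<ge>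
    1.\<close>
  define \<eta> where "\<eta> = e / (m + 1)"
  have \<eta>: "\<eta> > 0" using e m by (simp add: \<eta>_def)
  define U where "U s x = sqrt ((f (s *\<^sub>R ball_retraction x))\<^sup>2 + \<eta>\<^sup>2)" for s x
  have le: "\<bar>f (s *\<^sub>R ball_retraction x)\<bar> \<le> U s x" "U s x \<le> \<bar>f (s *\<^sub>R ball_retraction x)\<bar> + \<eta>" for s x
    unfolding U_def using sqrt_sum_squares_le_sum_abs[of "f (s *\<^sub>R ball_retraction x)" \<eta>] \<eta>
    by (auto intro: real_le_rsqrt)
  have i: "integrable lborel (\<lambda>x. indicator A x * \<bar>f (s *\<^sub>R ball_retraction x)\<bar>)"
    "integrable lborel (\<lambda>x. indicator A x * U s x)" if s: "\<bar>s\<bar> < 1" for s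
  proof -
    obtain B where B: "\<And>x. \<bar>f (s *\<^sub>R ball_retraction x)\<bar> \<le> B"
      using dilated_retraction_bounded[OF contf s] by blast
    have m: "(\<lambda>x. \<bar>f (s *\<^sub>R ball_retraction x)\<bar>) \<in> borel_measurable borel" "U s \<in> borel_measurable borel"
      unfolding U_def
      by (intro borel_measurable_continuous_onI continuous_intros continuous_on_dilated_retraction contf s)+
    show "integrable lborel (\<lambda>x. indicator A x * \<bar>f (s *\<^sub>R ball_retraction x)\<bar>)"
      by (rule integrable_indicator_ball[OF A m(1), where c = B]) (simp add: B)
    have "\<bar>U s x\<bar> \<le> B + \<eta>" for x
      using B[of x] le[where s = s and x = x] abs_ge_zero[of "f (s *\<^sub>R ball_retraction x)"] by linarith
    then show "integrable lborel (\<lambda>x. indicator A x * U s x)"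
      by (rule integrable_indicator_ball[OF A m(2)])
  qed
  have t1: "\<bar>t\<bar> < 1" "\<bar>t'\<bar> < 1" using t by auto
  have i1: "integrable lborel (\<lambda>x. indicator A x * (1::real))"
    by (rule integrable_indicator_ball[OF A, of _ 1]) auto
  have "?I t \<le> (\<integral>x. indicator A x * U t x \<partial>lborel)"
    unfolding A_def[symmetric]
    by (rule integral_mono[OF i[OF t1(1)]]) (simp add: mult_left_mono le(1))
  also have "\<dots> \<le> (\<integral>x. indicator A x * U t' x \<partial>lborel)"
    unfolding A_def U_def by (rule annulus_dilation_mono_sqrt[OF f t \<eta>])
  also have "\<dots> \<le> (\<integral>x. indicator A x * \<bar>f (t' *\<^sub>R ball_retraction x)\<bar> + \<eta> * (indicator A x * 1) \<partial>lborel)"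
    by (rule integral_mono[OF i(2)[OF t1(2)]])
       (intro Bochner_Integration.integrable_add integrable_mult_right i t1 i1, simp add: indicator_def le(2))
  also have "\<dots> = ?I t' + \<eta> * m"
    unfolding A_def[symmetric] m_def using i[OF t1(2)] i1 by simp
  also have "\<eta> * m \<le> e" using m e by (simp add: \<eta>_def field_simps)
  finally show "?I t \<le> ?I t' + e" by simp
qed

section \<open>Means over spheres\<close>

lemma measurable_sgn_sphere:
  "sgn \<in> restrict_space lborel (ball 0 1 - {0}) \<rightarrow>\<^sub>M restrict_space borel (sphere (0::'a::euclidean_space) 1)"
  by (rule measurable_restrict_space3) (auto simp: norm_sgn)

lemma sphere_measure_finite: "finite_measure (sphere_measure :: 'a::euclidean_space measure)"
  and space_sphere_measure: "space (sphere_measure :: 'a measure) = sphere 0 1"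
proof -
  show s: "space (sphere_measure :: 'a measure) = sphere 0 1"
    by (simp add: sphere_measure_def space_scale_measure space_restrict_space)
  show "finite_measure (sphere_measure :: 'a measure)"
    by (rule finite_measureI) (simp add: s emeasure_sphere_measure_sphere)
qed

lemma borel_measurable_sphere_measure:
  fixes g :: "'a::euclidean_space \<Rightarrow> real"
  assumes "continuous_on (sphere 0 1) g"
  shows "g \<in> borel_measurable sphere_measure"
proof -
  have "sets (sphere_measure :: 'a measure) = sets (restrict_space borel (sphere 0 1))"
    by (simp add: sphere_measure_def)
  then show ?thesis
    using borel_measurable_continuous_on_restrict[OF assms] measurable_cong_sets by blast
qed

lemma integrable_sphere_measure:
  fixes g :: "'a::euclidean_space \<Rightarrow> real"
  assumes g: "continuous_on (sphere 0 1) g"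
  shows "integrable sphere_measure g"
proof -
  have "compact (g ` sphere 0 1)" by (intro compact_continuous_image g) auto
  then obtain B where "\<And>x. norm x = 1 \<Longrightarrow> \<bar>g x\<bar> \<le> B"
    using compact_imp_bounded by (fastforce simp: bounded_iff)
  then show ?thesis
    by (intro finite_measure.integrable_const_bound[OF sphere_measure_finite, of _ B]
          borel_measurable_sphere_measure g AE_I2)
       (simp add: space_sphere_measure)
qed

lemma integral_sphere_measure:
  fixes g :: "'a::euclidean_space \<Rightarrow> real"
  assumes g: "continuous_on (sphere 0 1) g"
  shows "(\<integral>x. g x \<partial>sphere_measure) =
    DIM('a) / measure lborel (ball (0::'a) 1) * (\<integral>x. indicator {x. 0 < norm x \<and> norm x < 1} x * g (sgn x) \<partial>lborel)"
proof -
  define c where "c = DIM('a) / measure lborel (ball (0::'a) 1)"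
  have c: "c \<ge> 0" by (simp add: c_def)
  define N where "N = distr (restrict_space lborel (ball 0 1 - {0})) (restrict_space borel (sphere (0::'a) 1)) sgn"
  have gN: "g \<in> borel_measurable (restrict_space borel (sphere 0 1))"
    by (rule borel_measurable_continuous_on_restrict[OF g])
  then have gN': "g \<in> borel_measurable N" by (simp add: N_def)
  \<comment> \<open>Writing the scaling as a constant density makes \<open>integral_density\<close>
    applicable.\<close>
  have "(sphere_measure :: 'a measure) = density N (\<lambda>_. ennreal c)"
    unfolding sphere_measure_def N_def[symmetric] c_def[symmetric]
    by (rule measure_eqI) (simp_all add: emeasure_density_const)
  then have "(\<integral>x. g x \<partial>sphere_measure) = c * (\<integral>x. g x \<partial>N)"
    using integral_density[OF gN', of "\<lambda>_. c"] c by simp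
  also have "(\<integral>x. g x \<partial>N) = (\<integral>x. g (sgn x) \<partial>restrict_space lborel (ball 0 1 - {0}))"
    unfolding N_def by (rule integral_distr[OF measurable_sgn_sphere gN])
  also have "\<dots> = (\<integral>x. indicator (ball 0 1 - {0}) x * g (sgn x) \<partial>lborel)"
    by (subst integral_restrict_space) auto
  also have "ball 0 1 - {0} = {x::'a. 0 < norm x \<and> norm x < 1}" by auto
  finally show ?thesis by (simp add: c_def)
qed

text \<open>The function \<open>V (sgn x)\<close> is invariant under positive dilations, so scaling
  gives its integral over the punctured ball of radius \<rho> as \<rho>^n times that over the unit
  one; subtract. This takes the place of integration in polar coordinates.\<close>

lemma integral_annulus_sgn:
  fixes V :: "'a::euclidean_space \<Rightarrow> real"
  assumes V[measurable]: "V \<in> borel_measurable borel" and bound: "\<And>x. \<bar>V x\<bar> \<le> B" and \<rho>: "0 < \<rho>" "\<rho> < 1"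
  shows "(\<integral>x. indicator {x. \<rho> \<le> norm x \<and> norm x < 1} x * V (sgn x) \<partial>lborel)
    = (1 - \<rho> ^ DIM('a)) * (\<integral>x. indicator {x. 0 < norm x \<and> norm x < 1} x * V (sgn x) \<partial>lborel)"
proof -
  define H where "H r x = indicator {x. 0 < norm x \<and> norm x < r} x * V (sgn x)" for r and x :: 'a
  have meas[measurable]: "H r \<in> borel_measurable borel" for r
    unfolding H_def by measurable
  have int: "integrable lborel (H r)" if "r \<le> 1" for r
  proof -
    have m: "{x::'a. 0 < norm x \<and> norm x < r} \<in> sets borel" "(\<lambda>x. V (sgn x)) \<in> borel_measurable borel"
      by measurable
    have "{x::'a. 0 < norm x \<and> norm x < r} \<subseteq> ball 0 1" using that by auto
    then show ?thesis
      unfolding H_def by (rule integrable_indicator_ball[OF m(1) _ m(2) bound])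
  qed
  have "(\<integral>x. H \<rho> x \<partial>lborel) = (\<integral>x. H \<rho> x \<partial>density (distr lborel borel (\<lambda>x. 0 + \<rho> *\<^sub>R x)) (\<lambda>_. ennreal (\<bar>\<rho>\<bar>^DIM('a))))"
    using lborel_affine[of \<rho> "0::'a"] \<rho> by (simp add: ennreal_power)
  also have "\<dots> = \<rho> ^ DIM('a) * (\<integral>x. H \<rho> (\<rho> *\<^sub>R x) \<partial>lborel)"
    using \<rho> by (subst integral_density) (auto simp: integral_distr)
  also have "(\<lambda>x. H \<rho> (\<rho> *\<^sub>R x)) = H 1"
    using \<rho> by (auto simp: H_def indicator_def fun_eq_iff sgn_scaleR zero_less_mult_iff)
  finally have scale: "(\<integral>x. H \<rho> x \<partial>lborel) = \<rho> ^ DIM('a) * (\<integral>x. H 1 x \<partial>lborel)" .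
  have "(\<lambda>x. indicator {x. \<rho> \<le> norm x \<and> norm x < 1} x * V (sgn x)) = (\<lambda>x. H 1 x - H \<rho> x)"
    using \<rho> by (auto simp: H_def indicator_def fun_eq_iff)
  then have "(\<integral>x. indicator {x. \<rho> \<le> norm x \<and> norm x < 1} x * V (sgn x) \<partial>lborel) = (\<integral>x. H 1 x \<partial>lborel) - (\<integral>x. H \<rho> x \<partial>lborel)"
    using int[of 1] int[of \<rho>] \<rho> by simp
  then show ?thesis unfolding scale by (simp only: H_def[abs_def] left_diff_distrib mult_1)
qed

lemma M1_nonneg: "0 \<le> M1 f r"
  by (simp add: M1_def)

lemma continuous_on_sphere_dilated:
  fixes f :: "'a::euclidean_space \<Rightarrow> real"
  assumes "continuous_on (ball 0 1) f" and "\<bar>r\<bar> < 1"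
  shows "continuous_on (sphere 0 1) (\<lambda>x. f (r *\<^sub>R x))"
  by (rule continuous_on_compose2[OF assms(1)]) (use assms(2) in \<open>auto intro!: continuous_intros\<close>)

text \<open>The retraction acts trivially on \<open>sgn x\<close>. It is inserted so that the
  integrand is a function continuous on the whole space, evaluated at \<open>sgn x\<close>, as the
  comparison with annuli requires.\<close>

lemma M1_eq_integral_sgn:
  fixes f :: "'a::euclidean_space \<Rightarrow> real"
  assumes "continuous_on (ball 0 1) f" and "\<bar>r\<bar> < 1"
  shows "M1 f r = DIM('a) / measure lborel (ball (0::'a) 1) *
    (\<integral>x. indicator {x. 0 < norm x \<and> norm x < 1} x * \<bar>f (r *\<^sub>R ball_retraction (sgn x))\<bar> \<partial>lborel)"
proof -
  have "M1 f r = DIM('a) / measure lborel (ball (0::'a) 1) *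
    (\<integral>x. indicator {x. 0 < norm x \<and> norm x < 1} x * \<bar>f (r *\<^sub>R sgn x)\<bar> \<partial>lborel)"
    unfolding M1_def
    by (intro integral_sphere_measure continuous_intros continuous_on_sphere_dilated assms)
  moreover have "ball_retraction (sgn x) = sgn x" for x :: 'a
    by (rule ball_retraction_eq) (simp add: norm_sgn)
  ultimately show ?thesis by simp
qed

lemma close_to_sgn_near_sphere:
  fixes h :: "'a::euclidean_space \<Rightarrow> real"
  assumes h: "continuous_on (cball 0 1) h" and d: "d > 0"
  obtains \<rho> where "0 < \<rho>" "\<rho> < 1"
    and "\<And>x. \<rho> \<le> norm x \<Longrightarrow> norm x < 1 \<Longrightarrow> \<bar>h (sgn x) - h x\<bar> < d"
proof -
  have "uniformly_continuous_on (cball 0 1) h"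
    by (rule compact_uniformly_continuous[OF h]) simp
  then obtain \<delta> where \<delta>: "\<delta> > 0"
    "\<And>x y. norm x \<le> 1 \<Longrightarrow> norm y \<le> 1 \<Longrightarrow> dist y x < \<delta> \<Longrightarrow> \<bar>h y - h x\<bar> < d"
    using d unfolding uniformly_continuous_on_def dist_real_def by (metis mem_cball_0)
  show thesis
  \<comment> \<open>The bound 1/2 keeps x away from the origin, where \<open>sgn\<close>
    degenerates. Elsewhere \<open>sgn x\<close> has distance 1 - |x| from x, here at most \<delta> /
    2.\<close>
  proof (rule that[of "max (1/2) (1 - \<delta> / 2)"])
    show "0 < max (1/2) (1 - \<delta> / 2)" "max (1/2) (1 - \<delta> / 2) < 1" using \<delta>(1) by auto
    fix x :: 'a assume "max (1/2) (1 - \<delta> / 2) \<le> norm x" and x1: "norm x < 1"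
    then have x: "0 < norm x" "1 - norm x < \<delta>" using \<delta>(1) by auto
    have "sgn x - x = (1 - norm x) *\<^sub>R sgn x"
      using x by (simp add: sgn_div_norm algebra_simps)
    then have "dist (sgn x) x = 1 - norm x"
      using x x1 by (simp add: dist_norm norm_sgn)
    then show "\<bar>h (sgn x) - h x\<bar> < d"
      using x x1 by (intro \<delta>(2)) (auto simp: norm_sgn)
  qed
qed

text \<open>A thin annulus is a sphere up to the error \<open>d\<close>.\<close>

lemma integral_sgn_le_of_annulus_le:
  fixes h1 h2 :: "'a::euclidean_space \<Rightarrow> real"
  assumes h: "continuous_on UNIV h1" "continuous_on UNIV h2"
    and bound: "\<And>x. \<bar>h1 x\<bar> \<le> B1" "\<And>x. \<bar>h2 x\<bar> \<le> B2"
    and le: "\<And>\<rho>. (\<integral>x. indicator {x. \<rho> \<le> norm x \<and> norm x < 1} x * h1 x \<partial>lborel)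
      \<le> (\<integral>x. indicator {x. \<rho> \<le> norm x \<and> norm x < 1} x * h2 x \<partial>lborel)"
    and d: "d > 0"
  shows "(\<integral>x. indicator {x. 0 < norm x \<and> norm x < 1} x * h1 (sgn x) \<partial>lborel)
    \<le> (\<integral>x. indicator {x. 0 < norm x \<and> norm x < 1} x * h2 (sgn x) \<partial>lborel)
      + 2 * d * (\<integral>x. indicator {x::'a. 0 < norm x \<and> norm x < 1} x * 1 \<partial>lborel)"
    (is "?I1 \<le> ?I2 + 2 * d * ?v")
proof -
  obtain \<rho>1 where \<rho>1: "0 < \<rho>1" "\<rho>1 < 1" "\<And>x. \<rho>1 \<le> norm x \<Longrightarrow> norm x < 1 \<Longrightarrow> \<bar>h1 (sgn x) - h1 x\<bar> < d"
    using close_to_sgn_near_sphere[OF continuous_on_subset[OF h(1)] d] by blast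
  obtain \<rho>2 where \<rho>2: "0 < \<rho>2" "\<rho>2 < 1" "\<And>x. \<rho>2 \<le> norm x \<Longrightarrow> norm x < 1 \<Longrightarrow> \<bar>h2 (sgn x) - h2 x\<bar> < d"
    using close_to_sgn_near_sphere[OF continuous_on_subset[OF h(2)] d] by blast
  define \<rho> where "\<rho> = max \<rho>1 \<rho>2"
  have \<rho>: "0 < \<rho>" "\<rho> < 1" using \<rho>1 \<rho>2 by (auto simp: \<rho>_def)
  define A :: "'a set" where "A = {x. \<rho> \<le> norm x \<and> norm x < 1}"
  have A: "A \<in> sets borel" "A \<subseteq> ball 0 1" unfolding A_def by (measurable, auto)
  \<comment> \<open>q is the fraction of the ball's volume that the annulus fills. Each term below,
    including both errors of size d, carries this factor; it cancels, so the final error does not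
    grow as the annulus gets thinner.\<close>
  define q where "q = 1 - \<rho> ^ DIM('a)"
  have q: "q > 0" using \<rho> by (simp add: q_def power_less_one_iff)
  have close: "h1 (sgn x) \<le> h1 x + d" "h2 x \<le> h2 (sgn x) + d" if x: "x \<in> A" for x
  proof -
    have n: "\<rho>1 \<le> norm x" "\<rho>2 \<le> norm x" "norm x < 1" using x by (auto simp: A_def \<rho>_def)
    show "h1 (sgn x) \<le> h1 x + d" using \<rho>1(3)[OF n(1,3)] by linarith
    show "h2 x \<le> h2 (sgn x) + d" using \<rho>2(3)[OF n(2,3)] by linarith
  qed
  have m: "h1 \<in> borel_measurable borel" "h2 \<in> borel_measurable borel"
    by (rule borel_measurable_continuous_onI[OF h(1)] borel_measurable_continuous_onI[OF h(2)])+
  then have ms: "(\<lambda>x. h1 (sgn x)) \<in> borel_measurable borel" "(\<lambda>x. h2 (sgn x)) \<in> borel_measurable borel"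
    by measurable
  note i = integrable_indicator_ball[OF A m(1) bound(1)] integrable_indicator_ball[OF A m(2) bound(2)]
    integrable_indicator_ball[OF A ms(1) bound(1)] integrable_indicator_ball[OF A ms(2) bound(2)]
  have i1: "integrable lborel (\<lambda>x. indicator A x * (1::real))"
    by (rule integrable_indicator_ball[OF A, of _ 1]) auto
  have vol: "(\<integral>x. indicator A x * 1 \<partial>lborel) = q * ?v"
    unfolding A_def q_def by (intro integral_annulus_sgn[of "\<lambda>_. 1" 1] \<rho>) auto
  have "q * ?I1 = (\<integral>x. indicator A x * h1 (sgn x) \<partial>lborel)"
    unfolding A_def q_def by (rule integral_annulus_sgn[OF m(1) bound(1) \<rho>, symmetric])
  also have "\<dots> \<le> (\<integral>x. indicator A x * h1 x + d * (indicator A x * 1) \<partial>lborel)"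
    by (rule integral_mono[OF i(3)])
       (intro Bochner_Integration.integrable_add integrable_mult_right i i1, simp add: indicator_def close)
  also have "\<dots> = (\<integral>x. indicator A x * h1 x \<partial>lborel) + d * (q * ?v)"
    unfolding vol[symmetric] using i(1) i1 by simp
  also have "(\<integral>x. indicator A x * h1 x \<partial>lborel) \<le> (\<integral>x. indicator A x * h2 x \<partial>lborel)"
    unfolding A_def by (rule le)
  also have "\<dots> \<le> (\<integral>x. indicator A x * h2 (sgn x) + d * (indicator A x * 1) \<partial>lborel)"
    by (rule integral_mono[OF i(2)])
       (intro Bochner_Integration.integrable_add integrable_mult_right i i1, simp add: indicator_def close)
  also have "\<dots> = (\<integral>x. indicator A x * h2 (sgn x) \<partial>lborel) + d * (q * ?v)"
    unfolding vol[symmetric] using i(4) i1 by simp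
  also have "(\<integral>x. indicator A x * h2 (sgn x) \<partial>lborel) = q * ?I2"
    unfolding A_def q_def by (rule integral_annulus_sgn[OF m(2) bound(2) \<rho>])
  finally have "q * ?I1 \<le> q * (?I2 + 2 * d * ?v)" by (simp add: algebra_simps)
  then show ?thesis using q by simp
qed

lemma M1_mono:
  fixes f :: "'a::euclidean_space \<Rightarrow> real"
  assumes f: "f \<in> harmonic_on_ball" and t: "0 \<le> t" "t \<le> t'" "t' < 1"
  shows "M1 f t \<le> M1 f t'"
proof -
  have contf: "continuous_on (ball 0 1) f"
    using f by (simp add: harmonic_on_ball_def C2_on_ball_continuous)
  have t1: "\<bar>t\<bar> < 1" "\<bar>t'\<bar> < 1" using t by auto
  define h where "h s x = \<bar>f (s *\<^sub>R ball_retraction x)\<bar>" for s x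
  define I where "I s = (\<integral>x. indicator {x. 0 < norm x \<and> norm x < 1} x * h s (sgn x) \<partial>lborel)" for s
  define v where "v = (\<integral>x. indicator {x::'a. 0 < norm x \<and> norm x < 1} x * (1::real) \<partial>lborel)"
  have v: "v \<ge> 0" unfolding v_def by (rule integral_nonneg_AE) auto
  have h: "continuous_on UNIV (h t)" "continuous_on UNIV (h t')"
    unfolding h_def by (intro continuous_intros continuous_on_dilated_retraction contf t1)+
  obtain B1 where B1: "\<And>x. \<bar>h t x\<bar> \<le> B1"
    using dilated_retraction_bounded[OF contf t1(1)] by (auto simp: h_def)
  obtain B2 where B2: "\<And>x. \<bar>h t' x\<bar> \<le> B2"
    using dilated_retraction_bounded[OF contf t1(2)] by (auto simp: h_def)
  have "I t \<le> I t' + e" if e: "e > 0" for e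
  proof -
    \<comment> \<open>With this value for d the error 2 * d * v of the annulus comparison is at most
      e.\<close>
    have "e / (2 * (v + 1)) > 0" using v e by simp
    then have "I t \<le> I t' + 2 * (e / (2 * (v + 1))) * v"
      unfolding I_def v_def[symmetric]
      by (rule integral_sgn_le_of_annulus_le[OF h B1 B2, folded v_def, rotated])
         (simp only: h_def annulus_dilation_mono[OF f t])
    also have "2 * (e / (2 * (v + 1))) * v \<le> e" using v e by (simp add: field_simps)
    finally show ?thesis by simp
  qed
  then have "I t \<le> I t'" by (rule field_le_epsilon)
  then show ?thesis
    unfolding I_def h_def M1_eq_integral_sgn[OF contf t1(1)] M1_eq_integral_sgn[OF contf t1(2)]
    by (rule mult_left_mono) simp
qed

section \<open>Level sets and dilations\<close>

lemma M1_le: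
  fixes f :: "'a::euclidean_space \<Rightarrow> real" and c :: real
  assumes f: "continuous_on (sphere 0 1) (\<lambda>x. f (r *\<^sub>R x))"
    and c: "\<And>x. norm x = 1 \<Longrightarrow> \<bar>f (r *\<^sub>R x)\<bar> \<le> c"
  shows "M1 f r \<le> DIM('a) * c"
proof -
  interpret finite_measure "sphere_measure :: 'a measure" by (rule sphere_measure_finite)
  have "M1 f r \<le> (\<integral>x. c \<partial>(sphere_measure :: 'a measure))"
    unfolding M1_def
    by (intro integral_mono integrable_sphere_measure continuous_intros f)
       (auto simp: space_sphere_measure c)
  also have "\<dots> = DIM('a) * c"
    by (simp add: measure_def space_sphere_measure emeasure_sphere_measure_sphere)
  finally show ?thesis .
qed

lemma M1_triangle:
  fixes f g :: "'a::euclidean_space \<Rightarrow> real"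
  assumes "continuous_on (ball 0 1) f" "continuous_on (ball 0 1) g" "\<bar>r\<bar> < 1"
  shows "M1 f r \<le> M1 (\<lambda>x. f x - g x) r + M1 g r"
    and "M1 (\<lambda>x. f x - g x) r \<le> M1 f r + M1 g r"
proof -
  note c = continuous_on_sphere_dilated[OF assms(1,3)] continuous_on_sphere_dilated[OF assms(2,3)]
  have i: "integrable sphere_measure (\<lambda>x. \<bar>f (r *\<^sub>R x)\<bar>)" "integrable sphere_measure (\<lambda>x. \<bar>g (r *\<^sub>R x)\<bar>)"
    "integrable sphere_measure (\<lambda>x. \<bar>f (r *\<^sub>R x) - g (r *\<^sub>R x)\<bar>)"
    by (intro integrable_sphere_measure continuous_intros c)+
  show "M1 f r \<le> M1 (\<lambda>x. f x - g x) r + M1 g r"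
    unfolding M1_def Bochner_Integration.integral_add[OF i(3,2), symmetric]
    by (intro integral_mono i Bochner_Integration.integrable_add) auto
  show "M1 (\<lambda>x. f x - g x) r \<le> M1 f r + M1 g r"
    unfolding M1_def Bochner_Integration.integral_add[OF i(1,2), symmetric]
    by (intro integral_mono i Bochner_Integration.integrable_add) auto
qed

text \<open>A monotone function is Borel, so no measurability of parameter integrals has to be
  discussed. The indicator discards the radii outside [0, 1); from 1 on, the values of f are
  arbitrary.\<close>

lemma borel_measurable_M1:
  assumes "f \<in> harmonic_on_ball"
  shows "(\<lambda>r. indicator {0..<1} r * M1 f r) \<in> borel_measurable borel"
proof -
  have "mono_on {0..<1} (M1 f)"
    by (rule mono_onI) (auto intro: M1_mono[OF assms])
  then have "M1 f \<in> borel_measurable (restrict_space borel {0..<1})"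
    by (rule borel_measurable_mono_on_fnc)
  then show ?thesis
    by (subst (asm) borel_measurable_restrict_space_iff) auto
qed

section \<open>Dilates of harmonic functions and their membership in \<open>B_p\<close>\<close>

lemma has_derivative_partial_derivative_eq:
  "(f has_derivative f') (at x) \<Longrightarrow> partial_derivative f b x = f' b"
  unfolding partial_derivative_def using frechet_derivative_at by metis

text \<open>The factor c and the open set S serve the second derivatives: the first partial
  derivative of a dilate is \<rho> times a dilated partial derivative, but this identity is
  available only inside the ball.\<close>

lemma partial_derivative_dilation:
  fixes k :: "'a::euclidean_space \<Rightarrow> real"
  assumes "k differentiable (at (\<rho> *\<^sub>R x))" and "open S" "x \<in> S" and h: "\<And>y. y \<in> S \<Longrightarrow> h y = c * k (\<rho> *\<^sub>R y)"
  shows "h differentiable (at x)" and "partial_derivative h b x = c * \<rho> * partial_derivative k b (\<rho> *\<^sub>R x)"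
proof -
  let ?k' = "frechet_derivative k (at (\<rho> *\<^sub>R x))"
  have k: "(k has_derivative ?k') (at (\<rho> *\<^sub>R x))"
    using assms(1) by (simp add: frechet_derivative_works)
  have "((\<lambda>y. k (\<rho> *\<^sub>R y)) has_derivative (\<lambda>v. ?k' (\<rho> *\<^sub>R v))) (at x)"
    by (rule has_derivative_compose[where f = "\<lambda>y. \<rho> *\<^sub>R y" and g = k, OF _ k]) (auto intro!: derivative_eq_intros)
  then have "((\<lambda>y. c * k (\<rho> *\<^sub>R y)) has_derivative (\<lambda>v. c * ?k' (\<rho> *\<^sub>R v))) (at x)"
    by (rule has_derivative_mult_right)
  then have h': "(h has_derivative (\<lambda>v. c * ?k' (\<rho> *\<^sub>R v))) (at x)"
    by (rule has_derivative_transform_within_open[OF _ assms(2,3)]) (simp add: h)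
  then show "h differentiable (at x)" by (auto simp: differentiable_def)
  show "partial_derivative h b x = c * \<rho> * partial_derivative k b (\<rho> *\<^sub>R x)"
    using has_derivative_partial_derivative_eq[OF h', of b] linear_cmul[OF has_derivative_linear[OF k]]
    by (simp add: partial_derivative_def)
qed

lemma harmonic_dilation:
  fixes f :: "'a::euclidean_space \<Rightarrow> real"
  assumes f: "f \<in> harmonic_on_ball" and \<rho>: "0 \<le> \<rho>" "\<rho> \<le> 1"
  shows "(\<lambda>x. f (\<rho> *\<^sub>R x)) \<in> harmonic_on_ball"
proof -
  define g where "g x = f (\<rho> *\<^sub>R x)" for x
  have C2: "C2_on (ball 0 1) f" using f by (simp add: harmonic_on_ball_def)
  have ball: "norm (\<rho> *\<^sub>R x) < 1" if "norm x < 1" for x :: 'a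
    using that mult_right_mono[OF \<rho>(2), of "norm x"] \<rho>(1) by simp
  obtain b0 :: 'a where b0: "b0 \<in> Basis" using nonempty_Basis by blast
  have g1: "g differentiable (at x)" "partial_derivative g b x = \<rho> * partial_derivative f b (\<rho> *\<^sub>R x)"
    if "norm x < 1" for x b
    using partial_derivative_dilation[where k = f and \<rho> = \<rho> and x = x and S = UNIV and h = g and c = 1] C2_on_ballD(1)[OF C2 ball[OF that] b0]
    by (auto simp: g_def)
  have g2: "partial_derivative g b differentiable (at x)"
    "partial_derivative (partial_derivative g b) c x = \<rho> * \<rho> * partial_derivative (partial_derivative f b) c (\<rho> *\<^sub>R x)"
    if "norm x < 1" "b \<in> Basis" for x b c
    using partial_derivative_dilation[where k = "partial_derivative f b" and \<rho> = \<rho> and x = x and S = "ball 0 1" and h = "partial_derivative g b" and c = \<rho>]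
      C2_on_ballD(2)[OF C2 ball[OF that(1)] that(2)] that g1(2)
    by auto
  have "C2_on (ball 0 1) g"
    unfolding C2_on_def
  proof (intro conjI ballI)
    show "g differentiable_on ball 0 1"
      by (auto simp: differentiable_on_eq_differentiable_at intro: g1)
    show "partial_derivative g b differentiable_on ball 0 1" if "b \<in> Basis" for b
      using that by (auto simp: differentiable_on_eq_differentiable_at intro: g2)
    show "continuous_on (ball 0 1) (partial_derivative (partial_derivative g b) c)" if "b \<in> Basis" "c \<in> Basis" for b c
    proof -
      have "continuous_on (ball 0 1) (partial_derivative (partial_derivative f b) c)"
        using C2 that by (simp add: C2_on_def)
      then have "continuous_on (ball 0 1) (\<lambda>x. \<rho> * \<rho> * partial_derivative (partial_derivative f b) c (\<rho> *\<^sub>R x))"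
        by (intro continuous_intros continuous_on_compose2[of "ball 0 1" _ "ball 0 1" "\<lambda>x. \<rho> *\<^sub>R x"])
           (auto simp del: norm_scaleR intro: ball)
      then show ?thesis
        by (rule continuous_on_eq) (use that in \<open>simp add: g2\<close>)
    qed
  qed
  moreover have "laplacian g x = 0" if "norm x < 1" for x
  proof -
    have "laplacian g x = \<rho> * \<rho> * laplacian f (\<rho> *\<^sub>R x)"
      using that by (simp add: laplacian_def g2 sum_distrib_left)
    then show ?thesis using f ball[OF that] by (simp add: harmonic_on_ball_def)
  qed
  ultimately show ?thesis
    by (simp add: harmonic_on_ball_def g_def[abs_def])
qed

lemma nn_integral_one_minus_powr_finite:
  fixes a :: real
  assumes "a > 0"
  shows "(\<integral>\<^sup>+r. ennreal ((1 - r) powr (a - 1)) * indicator {0..<1} r \<partial>lborel) < \<infinity>"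
proof -
  have "((\<lambda>x. x powr (a - 1)) has_integral (1 powr (a - 1 + 1) / (a - 1 + 1))) {0..1}"
    using assms by (intro has_integral_powr_from_0) auto
  moreover have "(\<lambda>x. indicator {0..1} x * x powr (a - 1)) = (\<lambda>x. if x \<in> {0..1} then x powr (a - 1) else 0)"
    by (auto simp: indicator_def)
  ultimately have "((\<lambda>x. indicator {0..1} x * x powr (a - 1)) has_integral (1 / a)) UNIV"
    by (simp only: has_integral_restrict_UNIV) simp
  then have I: "(\<integral>\<^sup>+x. ennreal (indicator {0..1} x * x powr (a - 1)) \<partial>lborel) = ennreal (1 / a)"
    by (intro nn_integral_has_integral_lborel) auto
  have "(\<integral>\<^sup>+r. ennreal ((1 - r) powr (a - 1)) * indicator {0..<1} r \<partial>lborel)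
    \<le> (\<integral>\<^sup>+r. ennreal (indicator {0..1} (1 + -1 * r) * (1 + -1 * r) powr (a - 1)) \<partial>lborel)"
    by (intro nn_integral_mono) (auto simp: indicator_def)
  also have "\<dots> = (\<integral>\<^sup>+x. ennreal (indicator {0..1} x * x powr (a - 1)) \<partial>lborel)"
    using nn_integral_real_affine[of "\<lambda>x. ennreal (indicator {0..1} x * x powr (a - 1))" "-1" 1] by simp
  finally show ?thesis unfolding I by (simp add: le_less_trans)
qed

text \<open>By monotonicity all means of the dilate are at most M1 f \<rho>, and the remaining
  weight is integrable because \<alpha> * p > 0.\<close>

lemma dilation_in_B_p:
  fixes f :: "'a::euclidean_space \<Rightarrow> real"
  assumes f: "f \<in> harmonic_on_ball" and \<rho>: "0 \<le> \<rho>" "\<rho> < 1" and "p > 0" "\<alpha> > 0"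
  shows "(\<lambda>x. f (\<rho> *\<^sub>R x)) \<in> B_p p \<alpha>"
proof -
  let ?g = "\<lambda>x. f (\<rho> *\<^sub>R x)"
  have contf: "continuous_on (ball 0 1) f"
    using f by (simp add: harmonic_on_ball_def C2_on_ball_continuous)
  have g: "?g \<in> harmonic_on_ball" using f \<rho> by (intro harmonic_dilation) auto
  have "M1 ?g r powr p * (1 - r) powr (\<alpha> * p - 1) \<le> M1 f \<rho> powr p * (1 - r) powr (\<alpha> * p - 1)"
    if r: "0 \<le> r" "r < 1" for r
  proof -
    have "M1 ?g r = M1 f (\<rho> * r)" by (simp add: M1_def)
    also have "\<dots> \<le> M1 f \<rho>"
      using r \<rho> by (intro M1_mono f) (auto intro: mult_left_le)
    finally show ?thesis
      using \<open>p > 0\<close> by (intro mult_right_mono powr_mono2 M1_nonneg) auto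
  qed
  then have "(\<integral>\<^sup>+r\<in>{0..<1}. ennreal (M1 ?g r powr p * (1 - r) powr (\<alpha> * p - 1)) \<partial>lborel)
    \<le> (\<integral>\<^sup>+r. ennreal (M1 f \<rho> powr p) * (ennreal ((1 - r) powr (\<alpha> * p - 1)) * indicator {0..<1} r) \<partial>lborel)"
    by (intro nn_integral_mono) (auto simp: indicator_def ennreal_mult[symmetric] intro!: ennreal_leI)
  also have "\<dots> = ennreal (M1 f \<rho> powr p) * (\<integral>\<^sup>+r. ennreal ((1 - r) powr (\<alpha> * p - 1)) * indicator {0..<1} r \<partial>lborel)"
    by (rule nn_integral_cmult) measurable
  also have "\<dots> < \<infinity>"
    using nn_integral_one_minus_powr_finite[of "\<alpha> * p"] assms by (simp add: ennreal_mult_less_top)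
  finally show ?thesis using g by (simp add: B_p_def)
qed

section \<open>Level sets of finite mass\<close>

lemma nn_integral_tail_small:
  fixes F :: "real \<Rightarrow> ennreal"
  assumes F[measurable]: "F \<in> borel_measurable borel"
    and fin: "(\<integral>\<^sup>+r. F r * indicator {0..<1} r \<partial>lborel) < \<infinity>" and c: "c > 0"
  obtains a where "0 \<le> a" "a < 1" "(\<integral>\<^sup>+r. F r * indicator {a..<1} r \<partial>lborel) < c"
proof -
  \<comment> \<open>The sequence starts at 0, so the first of the decreasing integrals is finite, as
    monotone convergence from above demands.\<close>
  define a where "a i = 1 - inverse (real (Suc i))" for i
  have a: "0 \<le> a i" "a i < 1" "a i \<le> a (Suc i)" for i
    by (simp_all add: a_def field_simps)
  define F' where "F' i r = F r * indicator {a i..<1} r" for i r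
  have meas: "F' i \<in> borel_measurable lborel" for i
    unfolding F'_def by measurable
  have "decseq F'"
    using a(3) by (intro decseq_SucI le_funI) (auto simp: F'_def indicator_def intro: order_trans)
  moreover have "(\<integral>\<^sup>+r. F' 0 r \<partial>lborel) < \<infinity>"
    using fin by (simp add: F'_def a_def)
  ultimately have "(INF i. \<integral>\<^sup>+r. F' i r \<partial>lborel) = (\<integral>\<^sup>+r. (INF i. F' i r) \<partial>lborel)"
    using nn_integral_monotone_convergence_INF_decseq[of F' lborel 0] meas by simp
  also have "(\<lambda>r. INF i. F' i r) = (\<lambda>r. 0)"
  proof
    fix r
    obtain i where "F' i r = 0"
    proof (cases "r < 1")
      case True
      then obtain i where "inverse (real (Suc i)) < 1 - r"
        using reals_Archimedean[of "1 - r"] by auto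
      then have "F' i r = 0" by (simp add: F'_def a_def)
      then show thesis by (rule that)
    next
      case False
      then have "F' 0 r = 0" by (simp add: F'_def)
      then show thesis by (rule that)
    qed
    then have "(INF i. F' i r) \<le> 0" by (metis INF_lower UNIV_I)
    then show "(INF i. F' i r) = 0" by simp
  qed
  finally have "(INF i. \<integral>\<^sup>+r. F' i r \<partial>lborel) < c" using c by simp
  then obtain i where i: "(\<integral>\<^sup>+r. F' i r \<partial>lborel) < c" by (auto simp: INF_less_iff)
  show thesis by (rule that[OF a(1,2) i[unfolded F'_def]])
qed

lemma L_set_sets:
  assumes "f \<in> harmonic_on_ball"
  shows "L_set \<epsilon> \<alpha> f \<in> sets borel"
proof -
  have [measurable]: "(\<lambda>r. indicator {0..<1} r * M1 f r) \<in> borel_measurable borel"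
    by (rule borel_measurable_M1[OF assms])
  have "L_set \<epsilon> \<alpha> f = {r \<in> {0..<1}. (1 - r) powr \<alpha> * (indicator {0..<1} r * M1 f r) \<ge> \<epsilon>}"
    by (auto simp: L_set_def)
  also have "\<dots> \<in> sets borel" by measurable
  finally show ?thesis .
qed

text \<open>Up to the midpoint of [r, 1] the distance to 1 is at least halfway preserved, so the
  weight loses at most the factor 2^\<alpha>, while M1 f does not decrease.\<close>

lemma L_set_interval:
  assumes f: "f \<in> harmonic_on_ball" and \<alpha>: "\<alpha> > 0" and r: "0 \<le> r" "r < 1"
    and big: "2 powr \<alpha> * \<epsilon> < (1 - r) powr \<alpha> * M1 f r"
    and s: "s \<in> {r..(1 + r) / 2}"
  shows "s \<in> L_set \<epsilon> \<alpha> f"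
proof -
  have s: "r \<le> s" "s < 1" "1 - r \<le> 2 * (1 - s)" using r s by auto
  have "(1 - r) powr \<alpha> \<le> (2 * (1 - s)) powr \<alpha>" using s r \<alpha> by (intro powr_mono2) auto
  also have "\<dots> = 2 powr \<alpha> * (1 - s) powr \<alpha>" by (rule powr_mult)
  finally have "(1 - r) powr \<alpha> * M1 f r \<le> 2 powr \<alpha> * (1 - s) powr \<alpha> * M1 f s"
    using M1_mono[OF f r(1) s(1,2)] by (intro mult_mono) (auto simp: M1_nonneg)
  with big have "2 powr \<alpha> * \<epsilon> < 2 powr \<alpha> * ((1 - s) powr \<alpha> * M1 f s)"
    by (simp only: mult.assoc less_le_trans)
  then have "\<epsilon> \<le> (1 - s) powr \<alpha> * M1 f s"
    by (subst (asm) mult_less_cancel_left_pos) auto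
  then show ?thesis using s r by (simp add: L_set_def)
qed

lemma M1_eventually_le:
  fixes f :: "'a::euclidean_space \<Rightarrow> real"
  assumes f: "f \<in> harmonic_on_ball" and \<alpha>: "\<alpha> > 0"
    and fin: "(\<integral>\<^sup>+r\<in>{0..<1}. ennreal (indicator (L_set \<epsilon> \<alpha> f) r * inverse (1 - r)) \<partial>lborel) < \<infinity>"
  obtains a where "0 \<le> a" "a < 1"
    and "\<And>r. a \<le> r \<Longrightarrow> r < 1 \<Longrightarrow> (1 - r) powr \<alpha> * M1 f r \<le> 2 powr \<alpha> * \<epsilon>"
proof -
  define F where "F r = ennreal (indicator (L_set \<epsilon> \<alpha> f) r * inverse (1 - r))" for r
  have [measurable]: "L_set \<epsilon> \<alpha> f \<in> sets borel" by (rule L_set_sets[OF f])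
  have F: "F \<in> borel_measurable borel" unfolding F_def by measurable
  have "0 < ennreal (1/2)" by (simp only: ennreal_less_zero_iff half_gt_zero_iff zero_less_one)
  then obtain a where a: "0 \<le> a" "a < 1" and small: "(\<integral>\<^sup>+r. F r * indicator {a..<1} r \<partial>lborel) < ennreal (1/2)"
    using nn_integral_tail_small[OF F] fin unfolding F_def by blast
  have "(1 - r) powr \<alpha> * M1 f r \<le> 2 powr \<alpha> * \<epsilon>" if r: "a \<le> r" "r < 1" for r
  proof (rule ccontr)
    assume "\<not> ?thesis"
    then have L: "s \<in> L_set \<epsilon> \<alpha> f" if "s \<in> {r..(1 + r) / 2}" for s
      using L_set_interval[OF f \<alpha> _ r(2) _ that] a r by simp
    \<comment> \<open>Bounding 1/(1 - s) below by its value at the left endpoint, times the length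
      (1 - r)/2, gives 1/2. The exact mass log 2 is not computed.\<close>
    have "ennreal (inverse (1 - r)) * indicator {r..(1 + r) / 2} s \<le> F s * indicator {a..<1} s" for s
    proof (cases "s \<in> {r..(1 + r) / 2}")
      case True
      then have s: "r \<le> s" "s < 1" using r by auto
      then have "inverse (1 - r) \<le> inverse (1 - s)" by (intro le_imp_inverse_le) auto
      then show ?thesis using True s r L[OF True] by (simp add: F_def ennreal_leI)
    qed simp
    then have "(\<integral>\<^sup>+s. ennreal (inverse (1 - r)) * indicator {r..(1 + r) / 2} s \<partial>lborel)
      \<le> (\<integral>\<^sup>+s. F s * indicator {a..<1} s \<partial>lborel)"
      by (rule nn_integral_mono)
    also have "(\<integral>\<^sup>+s. ennreal (inverse (1 - r)) * indicator {r..(1 + r) / 2} s \<partial>lborel)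
      = ennreal (inverse (1 - r)) * ennreal ((1 + r) / 2 - r)"
      using r by (subst nn_integral_cmult_indicator) auto
    also have "\<dots> = ennreal (1/2)"
      using r by (subst ennreal_mult[symmetric]) (auto simp: field_simps)
    finally show False using small by simp
  qed
  with a show thesis by (rule that)
qed

lemma uniformly_close_dilation:
  fixes f :: "'a::euclidean_space \<Rightarrow> real"
  assumes f: "continuous_on (ball 0 1) f" and R: "R < 1" and e: "e > 0"
  obtains \<delta> where "\<delta> > 0"
    and "\<And>\<rho> x. 0 \<le> \<rho> \<Longrightarrow> \<rho> \<le> 1 \<Longrightarrow> 1 - \<rho> < \<delta> \<Longrightarrow> norm x \<le> R \<Longrightarrow> \<bar>f x - f (\<rho> *\<^sub>R x)\<bar> < e"
proof -
  have "uniformly_continuous_on (cball 0 R) f"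
    by (rule compact_uniformly_continuous) (use R in \<open>auto intro: continuous_on_subset[OF f]\<close>)
  then obtain \<delta> where \<delta>: "\<delta> > 0"
    "\<And>x y. norm x \<le> R \<Longrightarrow> norm y \<le> R \<Longrightarrow> dist y x < \<delta> \<Longrightarrow> \<bar>f y - f x\<bar> < e"
    using e unfolding uniformly_continuous_on_def dist_real_def by (metis mem_cball_0)
  have "\<bar>f x - f (\<rho> *\<^sub>R x)\<bar> < e" if \<rho>: "0 \<le> \<rho>" "\<rho> \<le> 1" "1 - \<rho> < \<delta>" and x: "norm x \<le> R" for \<rho> x
  proof (rule \<delta>(2)[OF _ x])
    have x1: "norm x \<le> 1" using x R by simp
    show "norm (\<rho> *\<^sub>R x) \<le> R"
      using \<rho> x mult_left_le_one_le[of "norm x" \<rho>] by simp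
    have "x - \<rho> *\<^sub>R x = (1 - \<rho>) *\<^sub>R x" by (simp add: algebra_simps)
    then have "dist x (\<rho> *\<^sub>R x) = (1 - \<rho>) * norm x" using \<rho> by (simp add: dist_norm)
    also have "\<dots> \<le> 1 - \<rho>" using \<rho> x1 by (simp add: mult_left_le)
    finally show "dist x (\<rho> *\<^sub>R x) < \<delta>" using \<rho> by simp
  qed
  with \<delta>(1) show thesis by (rule that)
qed

section \<open>The two inequalities between \<open>s1\<close> and \<open>s2\<close>\<close>

lemma s1_le:
  fixes f :: "'a::euclidean_space \<Rightarrow> real"
  assumes f: "f \<in> harmonic_on_ball" and p: "p > 0" and \<alpha>: "\<alpha> > 0" and \<epsilon>: "\<epsilon> > 0"
    and fin: "(\<integral>\<^sup>+r\<in>{0..<1}. ennreal (indicator (L_set \<epsilon> \<alpha> f) r * inverse (1 - r)) \<partial>lborel) < \<infinity>"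
  shows "s1 p \<alpha> f \<le> ennreal (2 * 2 powr \<alpha> * \<epsilon>)"
proof -
  have contf: "continuous_on (ball 0 1) f"
    using f by (simp add: harmonic_on_ball_def C2_on_ball_continuous)
  obtain r1 where r1: "0 \<le> r1" "r1 < 1"
    and tail: "\<And>r. r1 \<le> r \<Longrightarrow> r < 1 \<Longrightarrow> (1 - r) powr \<alpha> * M1 f r \<le> 2 powr \<alpha> * \<epsilon>"
    using M1_eventually_le[OF f \<alpha> fin] by blast
  \<comment> \<open>The gap between r1 and r0 gives a dilation room to shrink a radius r \<ge> r0
    without leaving the range of the tail bound.\<close>
  define r0 where "r0 = (1 + r1) / 2"
  have r0: "r1 < r0" "r0 < 1" "0 < r0" using r1 by (auto simp: r0_def)
  \<comment> \<open>The sphere has mass \<open>DIM('a)\<close>, so a uniform error e on it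
    contributes \<epsilon> to the mean.\<close>
  define e where "e = \<epsilon> / DIM('a)"
  have e: "e > 0" using \<epsilon> by (simp add: e_def)
  obtain \<delta> where \<delta>: "\<delta> > 0" "\<And>\<rho> x. 0 \<le> \<rho> \<Longrightarrow> \<rho> \<le> 1 \<Longrightarrow> 1 - \<rho> < \<delta> \<Longrightarrow> norm x \<le> r0 \<Longrightarrow> \<bar>f x - f (\<rho> *\<^sub>R x)\<bar> < e"
    using uniformly_close_dilation[OF contf r0(2) e] by blast
  \<comment> \<open>The first entry ensures \<rho> * r \<ge> r1 for r \<ge> r0. The second one
    ensures 1 - \<rho> \<le> \<delta> / 2 and \<rho> \<ge> 1/2.\<close>
  define \<rho> where "\<rho> = max (r1 / r0) (1 - min \<delta> 1 / 2)"
  have \<rho>: "r1 / r0 \<le> \<rho>" "0 < \<rho>" "\<rho> < 1" "1 - \<rho> < \<delta>"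
    using \<delta>(1) r0 by (auto simp: \<rho>_def)
  define g where "g x = f (\<rho> *\<^sub>R x)" for x
  have g: "g \<in> B_p p \<alpha>" unfolding g_def using dilation_in_B_p[OF f _ _ p \<alpha>, of \<rho>] \<rho> by simp
  then have contg: "continuous_on (ball 0 1) g"
    by (simp add: B_p_def harmonic_on_ball_def C2_on_ball_continuous)
  have two: "1 \<le> 2 powr \<alpha>" using \<alpha> by (simp add: ge_one_powr_ge_zero)
  have "norm_B_inf \<alpha> (\<lambda>x. f x - g x) \<le> ennreal (2 * 2 powr \<alpha> * \<epsilon>)"
    unfolding norm_B_inf_def
  proof (intro SUP_least ennreal_leI)
    fix r :: real assume "r \<in> {0..<1}"
    then have r: "0 \<le> r" "r < 1" by auto
    show "M1 (\<lambda>x. f x - g x) r * (1 - r) powr \<alpha> \<le> 2 * 2 powr \<alpha> * \<epsilon>"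
    proof (cases "r \<ge> r0")
      case True
      have le: "\<rho> * r \<le> r" using r \<rho> by (simp add: mult_left_le_one_le)
      have "r1 = r1 / r0 * r0" using r0 by simp
      also have "\<dots> \<le> \<rho> * r" using \<rho> r0 r1 True by (intro mult_mono) auto
      finally have ge: "r1 \<le> \<rho> * r" .
      have "M1 (\<lambda>x. f x - g x) r \<le> M1 f r + M1 g r"
        using r by (intro M1_triangle contf contg) auto
      also have "M1 g r = M1 f (\<rho> * r)" by (simp add: M1_def g_def)
      finally have "M1 (\<lambda>x. f x - g x) r * (1 - r) powr \<alpha> \<le> (M1 f r + M1 f (\<rho> * r)) * (1 - r) powr \<alpha>"
        by (intro mult_right_mono) auto
      also have "\<dots> = (1 - r) powr \<alpha> * M1 f r + (1 - r) powr \<alpha> * M1 f (\<rho> * r)"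
        by (simp add: algebra_simps)
      also have "(1 - r) powr \<alpha> * M1 f r \<le> 2 powr \<alpha> * \<epsilon>" using True r r0 by (intro tail) auto
      \<comment> \<open>The smaller radius \<rho> * r has the larger weight, so the tail bound for f
        at \<rho> * r also controls the dilate at r.\<close>
      also have "(1 - r) powr \<alpha> * M1 f (\<rho> * r) \<le> (1 - \<rho> * r) powr \<alpha> * M1 f (\<rho> * r)"
        using le r \<alpha> by (intro mult_right_mono powr_mono2 M1_nonneg) auto
      also have "\<dots> \<le> 2 powr \<alpha> * \<epsilon>" using ge le r by (intro tail) auto
      finally show ?thesis by (simp only: mult_2 distrib_right)
    next
      case False
      have "M1 (\<lambda>x. f x - g x) r \<le> DIM('a) * e"
      proof (rule M1_le)
        show "continuous_on (sphere 0 1) (\<lambda>x. f (r *\<^sub>R x) - g (r *\<^sub>R x))"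
          using r by (intro continuous_on_diff continuous_on_sphere_dilated contf contg) auto
        fix x :: 'a assume x: "norm x = 1"
        have "\<bar>f (r *\<^sub>R x) - f (\<rho> *\<^sub>R (r *\<^sub>R x))\<bar> < e"
          using x r False \<rho> by (intro \<delta>(2)) auto
        then show "\<bar>f (r *\<^sub>R x) - g (r *\<^sub>R x)\<bar> \<le> e" by (simp add: g_def)
      qed
      also have "\<dots> = \<epsilon>" by (simp add: e_def)
      finally have "M1 (\<lambda>x. f x - g x) r * (1 - r) powr \<alpha> \<le> \<epsilon> * 1"
        using r \<alpha> \<epsilon> by (intro mult_mono powr_le1) auto
      also have "\<dots> \<le> 2 * 2 powr \<alpha> * \<epsilon>" using two \<epsilon> by simp
      finally show ?thesis .
    qed
  qed
  then show ?thesis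
    unfolding s1_def by (rule INF_lower2[OF g])
qed

text \<open>If the weighted mean of f is at least 2c and that of f - g at most c, then that of g is
  at least c. The factor 2 splits the level evenly between f - g and g.\<close>

lemma s2_le:
  fixes f g :: "'a::euclidean_space \<Rightarrow> real"
  assumes f: "f \<in> harmonic_on_ball" and g: "g \<in> B_p p \<alpha>" and p: "p > 0"
  shows "s2 \<alpha> f \<le> 2 * norm_B_inf \<alpha> (\<lambda>x. f x - g x)"
proof (cases "norm_B_inf \<alpha> (\<lambda>x. f x - g x)")
  case (real d)
  have gh: "g \<in> harmonic_on_ball" using g by (simp add: B_p_def)
  have contf: "continuous_on (ball 0 1) f" and contg: "continuous_on (ball 0 1) g"
    using f gh by (simp_all add: harmonic_on_ball_def C2_on_ball_continuous)
  have diff: "M1 (\<lambda>x. f x - g x) r * (1 - r) powr \<alpha> \<le> d" if "0 \<le> r" "r < 1" for r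
  proof -
    have "ennreal (M1 (\<lambda>x. f x - g x) r * (1 - r) powr \<alpha>) \<le> ennreal d"
      using that unfolding real(2)[symmetric] norm_B_inf_def by (intro SUP_upper) auto
    then show ?thesis using real(1) by (simp add: ennreal_le_iff)
  qed
  have [measurable]: "(\<lambda>r. indicator {0..<1} r * M1 g r) \<in> borel_measurable borel"
    by (rule borel_measurable_M1[OF gh])
  define H where "H r = ennreal (M1 g r powr p * (1 - r) powr (\<alpha> * p - 1)) * indicator {0..<1} r" for r
  \<comment> \<open>Borel measurability of M1 g is known only after cutting off to [0, 1), hence the
    inner indicator.\<close>
  have "H = (\<lambda>r. ennreal ((indicator {0..<1} r * M1 g r) powr p * (1 - r) powr (\<alpha> * p - 1)) * indicator {0..<1} r)"
    by (auto simp: H_def indicator_def)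
  also have "\<dots> \<in> borel_measurable lborel" by measurable
  finally have H[measurable]: "H \<in> borel_measurable lborel" .
  \<comment> \<open>The slack e makes the level positive even when the norm d is 0; it tends to 0 at
    the end.\<close>
  have "s2 \<alpha> f \<le> ennreal (2 * (d + e))" if e: "e > 0" for e
  proof -
    define c where "c = d + e"
    have c: "c > 0" "d \<le> c" using e real(1) by (auto simp: c_def)
    \<comment> \<open>Chebyshev's inequality in pointwise form: on the level set the p-th power of
      the weighted mean of g, divided by c^p, is at least 1. Multiplication by 1/(1 - r) lowers the
      exponent \<alpha> * p to the \<alpha> * p - 1 of the \<open>B_p\<close> integral.\<close>
    have "ennreal (indicator (L_set (2 * c) \<alpha> f) r * inverse (1 - r)) * indicator {0..<1} r \<le> ennreal (c powr (- p)) * H r" for r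
    proof (cases "r \<in> L_set (2 * c) \<alpha> f")
      case True
      then have r: "0 \<le> r" "r < 1" and big: "2 * c \<le> (1 - r) powr \<alpha> * M1 f r"
        by (auto simp: L_set_def)
      have "M1 f r \<le> M1 (\<lambda>x. f x - g x) r + M1 g r"
        using r by (intro M1_triangle contf contg) auto
      then have "(1 - r) powr \<alpha> * M1 f r \<le> (1 - r) powr \<alpha> * (M1 (\<lambda>x. f x - g x) r + M1 g r)"
        by (intro mult_left_mono) auto
      then have ge: "c \<le> M1 g r * (1 - r) powr \<alpha>"
        using big diff[OF r] c(2) by (simp add: algebra_simps)
      have "1 = c powr (- p) * c powr p" using c by (simp add: powr_minus)
      also have "\<dots> \<le> c powr (- p) * (M1 g r * (1 - r) powr \<alpha>) powr p"
        using ge c p by (intro mult_left_mono powr_mono2) auto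
      also have "(M1 g r * (1 - r) powr \<alpha>) powr p = M1 g r powr p * (1 - r) powr (\<alpha> * p)"
        by (simp add: powr_mult M1_nonneg powr_powr)
      finally have "1 * inverse (1 - r) \<le> c powr (- p) * (M1 g r powr p * (1 - r) powr (\<alpha> * p)) * inverse (1 - r)"
        using r by (intro mult_right_mono) auto
      also have "\<dots> = c powr (- p) * (M1 g r powr p * (1 - r) powr (\<alpha> * p - 1))"
        using r by (simp add: powr_diff divide_inverse)
      finally show ?thesis
        using True r by (simp add: H_def ennreal_mult[symmetric] ennreal_leI)
    qed auto
    then have "(\<integral>\<^sup>+r\<in>{0..<1}. ennreal (indicator (L_set (2 * c) \<alpha> f) r * inverse (1 - r)) \<partial>lborel)
      \<le> (\<integral>\<^sup>+r. ennreal (c powr (- p)) * H r \<partial>lborel)"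
      by (rule nn_integral_mono)
    also have "\<dots> = ennreal (c powr (- p)) * (\<integral>\<^sup>+r. H r \<partial>lborel)"
      by (rule nn_integral_cmult[OF H])
    also have "\<dots> < \<infinity>"
      using g by (simp add: B_p_def H_def ennreal_mult_less_top)
    finally show ?thesis
      unfolding s2_def c_def[symmetric] by (intro INF_lower) (use c in auto)
  qed
  note bound = this
  have "s2 \<alpha> f \<le> ennreal (2 * d) + ennreal e" if "e > 0" for e
  proof -
    have "ennreal (2 * d) + ennreal e = ennreal (2 * (d + e / 2))"
      using that real(1) by (subst ennreal_plus[symmetric]) auto
    then show ?thesis using bound[of "e / 2"] that by simp
  qed
  then have "s2 \<alpha> f \<le> ennreal (2 * d)"
    by (rule ennreal_le_epsilon)
  then show ?thesis using real by (simp add: ennreal_mult)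
next
  case top
  then show ?thesis by (simp add: ennreal_mult_top)
qed

theorem theorem2p1:
  fixes p \<alpha> :: real
  assumes "1 \<le> p" and "0 < \<alpha>"
  shows "\<exists>C::real. 1 \<le> C \<and>
    (\<forall>f :: real ^ 'n \<Rightarrow> real. f \<in> B_inf \<alpha> \<longrightarrow>
       ennreal (inverse C) * s2 \<alpha> f \<le> s1 p \<alpha> f \<and> s1 p \<alpha> f \<le> ennreal C * s2 \<alpha> f)"
proof -
  \<comment> \<open>This is the constant of \<open>s1_le\<close>; as it is at least 2, it also
    serves for \<open>s2_le\<close>.\<close>
  define C :: real where "C = 2 * 2 powr \<alpha>"
  have C2: "2 \<le> C" using assms by (simp add: C_def ge_one_powr_ge_zero)
  have "inverse C * C = 1" using C2 by simp
  then have inv: "ennreal (inverse C) * ennreal C = 1"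
    using ennreal_mult[of "inverse C" C] C2 by simp
  have "ennreal (inverse C) * s2 \<alpha> f \<le> s1 p \<alpha> f \<and> s1 p \<alpha> f \<le> ennreal C * s2 \<alpha> f"
    if "f \<in> B_inf \<alpha>" for f :: "real ^ 'n \<Rightarrow> real"
  proof
    have f: "f \<in> harmonic_on_ball" using that by (simp add: B_inf_def)
    show "ennreal (inverse C) * s2 \<alpha> f \<le> s1 p \<alpha> f"
      unfolding s1_def
    proof (rule INF_greatest)
      fix g :: "real ^ 'n \<Rightarrow> real" assume g: "g \<in> B_p p \<alpha>"
      let ?N = "norm_B_inf \<alpha> (\<lambda>x. f x - g x)"
      have "s2 \<alpha> f \<le> 2 * ?N"
        using assms(1) by (intro s2_le[OF f g]) simp
      also have "2 * ?N \<le> ennreal C * ?N"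
        using ennreal_leI[OF C2] by (intro mult_right_mono) simp_all
      finally have "ennreal (inverse C) * s2 \<alpha> f \<le> ennreal (inverse C) * (ennreal C * ?N)"
        by (rule mult_left_mono) simp
      also have "\<dots> = ?N" by (simp only: mult.assoc[symmetric] inv mult_1)
      finally show "ennreal (inverse C) * s2 \<alpha> f \<le> ?N" .
    qed
    \<comment> \<open>With C moved to the left, the claim is a lower bound for the infimum
      \<open>s2\<close> and can be checked for each \<epsilon> separately.\<close>
    have "ennreal (inverse C) * s1 p \<alpha> f \<le> s2 \<alpha> f"
      unfolding s2_def
    proof (rule INF_greatest)
      fix \<epsilon> assume "\<epsilon> \<in> {\<epsilon>. 0 < \<epsilon> \<and> (\<integral>\<^sup>+r\<in>{0..<1}. ennreal (indicator (L_set \<epsilon> \<alpha> f) r * inverse (1 - r)) \<partial>lborel) < \<infinity>}"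
      then have \<epsilon>: "\<epsilon> > 0"
        and fin: "(\<integral>\<^sup>+r\<in>{0..<1}. ennreal (indicator (L_set \<epsilon> \<alpha> f) r * inverse (1 - r)) \<partial>lborel) < \<infinity>"
        by auto
      have "s1 p \<alpha> f \<le> ennreal (C * \<epsilon>)"
        unfolding C_def using assms by (intro s1_le[OF f _ _ \<epsilon> fin]) auto
      also have "ennreal (C * \<epsilon>) = ennreal C * ennreal \<epsilon>"
        using C2 \<epsilon> by (intro ennreal_mult) auto
      finally have "ennreal (inverse C) * s1 p \<alpha> f \<le> ennreal (inverse C) * (ennreal C * ennreal \<epsilon>)"
        by (rule mult_left_mono) simp
      also have "\<dots> = ennreal \<epsilon>" by (simp only: mult.assoc[symmetric] inv mult_1)
      finally show "ennreal (inverse C) * s1 p \<alpha> f \<le> ennreal \<epsilon>" .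
    qed
    then have "ennreal C * (ennreal (inverse C) * s1 p \<alpha> f) \<le> ennreal C * s2 \<alpha> f"
      by (rule mult_left_mono) simp
    moreover have "ennreal C * (ennreal (inverse C) * s1 p \<alpha> f) = s1 p \<alpha> f"
      by (simp only: mult.assoc[symmetric] inv[unfolded mult.commute[of "ennreal (inverse C)"]] mult_1)
    ultimately show "s1 p \<alpha> f \<le> ennreal C * s2 \<alpha> f" by (simp only:)
  qed
  then show ?thesis using C2 by (intro exI[of _ C]) auto
qed

end
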